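(* Let $\mathbb{F}$ be an arbitrary field, $G$ a torsion-free group, and let $\gamma,\delta$ be elements of the group algebra $\mathbb{F}[G]$. If $|supp(\gamma)|=3$ and $\gamma\delta=1$, then $|supp(\delta)|\geq 9$.
   Context: For $\gamma=\sum_{x\in G}a_xx\in\mathbb{F}[G]$, $supp(\gamma)=\{x\in G: a_x\neq 0\}$. *)

theory Defs
  imports "HOL-Library.Poly_Mapping"
begin

text \<open>
  The group is a type of class \<^class>\<open>group_add\<close>: it is written additively, with identity
  \<open>0\<close>, but commutativity is not assumed (that would be \<^class>\<open>ab_group_add\<close>).
  The group algebra of such a group \<open>'g\<close> over a field \<open>'f\<close> is the type
  \<open>'g \<Rightarrow>\<^sub>0 'f\<close> of finitely supported functions with the library's convolution product
  and unit; the support of an element \<open>\<gamma>\<close> is \<open>Poly_Mapping.keys \<gamma>\<close>.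

  \<open>((+) x ^^ n) 0\<close> is the \<open>n\<close>-fold sum \<open>x + \<dots> + x\<close>, that is, the \<open>n\<close>-th power of \<open>x\<close>
  in multiplicative notation.
\<close>

definition torsion_free :: "'g::group_add itself \<Rightarrow> bool" where
  "torsion_free _ \<longleftrightarrow> (\<forall>(x::'g) n. n > 0 \<longrightarrow> ((+) x ^^ n) 0 = 0 \<longrightarrow> x = 0)"

end

theory Submission
  imports Defs "HOL-Library.Product_Plus"
begin

text \<open>
  Let \<open>A\<close> and \<open>B\<close> be the supports of \<open>\<gamma>\<close> and \<open>\<delta>\<close>. At most one pair in \<open>A \<times> B\<close> has a unique
  product. Join \<open>b, c \<in> B\<close> whenever \<open>a + b = a' + c\<close> with \<open>a \<noteq> a'\<close> in \<open>A\<close>: apart from one edge that may be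
  missing, every \<open>b\<close> has three neighbours, one for each \<open>a \<in> A\<close>, so a graph without cycles of length at
  most 4 has at least \<open>1 + 3 + 6 - 1\<close> vertices. A short cycle is a short relation between \<open>x = - p + q\<close>
  and \<open>y = - p + r\<close>, where \<open>A = {p, q, r}\<close>. Almost all of these relations make the group generated by
  \<open>x\<close> and \<open>y\<close> a quotient of a Baumslag-Solitar group; being torsion-free, it then maps
  nontrivially to the integers, and the top and bottom layers of this grading contain two unique products.

  The exceptions are two families of 4-cycles whose relations present the trefoil group. Two
  inequivalent ones of these produce torsion, so a single relation governs all 4-cycles. A suitable root
  \<open>s\<close> then has at most one coincidence among its six vertices at distance 2, which again
  gives 9 vertices, except in one configuration of exactly 8 vertices that cannot be completed.
\<close>

section \<open>Integer multiples and generated subgroups\<close>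

text \<open>A torsion-free group need not be orderable, and its finite subsets need not have unique
  products, so nothing can be read off from extreme elements of the supports. Extreme elements exist
  only relative to a map to the integers, and such a map has to be made from a relation. To know a
  relation is to know that the group generated by \<open>x\<close> and \<open>y\<close> is some
  quotient of the presented group, so the map must survive in every quotient that can occur. For a
  Baumslag-Solitar relation it does: if it failed, a multiple of \<open>t\<close> would commute with
  \<open>s\<close> although conjugation by \<open>s\<close> multiplies it by \<open>k\<close>. A
  trefoil relation offers no such argument, which is why those 4-cycles are counted and not
  excluded. Cycles of 2, 3 and 4 edges give colour words of 4, 6 and 8 letters, 18, 66 and 258 of
  them; up to rereading and renaming, 2, 4 and 10 representatives remain.\<close>

definition zmul :: "int \<Rightarrow> 'a::group_add \<Rightarrow> 'a" where
  "zmul i x = (if 0 \<le> i then ((+) x ^^ nat i) 0 else ((+) (- x) ^^ nat (- i)) 0)"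

lemma zmul_0 [simp]: "zmul 0 x = 0"
  by (simp add: zmul_def)

lemma zmul_plus_one: "zmul (i + 1) x = x + zmul i x"
proof (cases "0 \<le> i")
  case True
  then show ?thesis by (simp add: zmul_def nat_add_distrib)
next
  case False
  then have "nat (- i) = Suc (nat (- (i + 1)))"
    by simp
  with False show ?thesis
    by (auto simp: zmul_def simp flip: add.assoc)
qed

lemma zmul_minus_one: "zmul (i - 1) x = - x + zmul i x"
  using zmul_plus_one[of "i - 1" x] by (simp flip: add.assoc)

lemma zmul_1 [simp]: "zmul 1 x = x"
  using zmul_plus_one[of 0 x] by simp

lemma zmul_add: "zmul (i + j) x = zmul i x + zmul j x"
proof (induction i rule: int_induct[of _ 0])
  case (step1 i)
  have "i + 1 + j = i + j + 1" by simp
  then show ?case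
    using step1 zmul_plus_one[of "i + j" x] zmul_plus_one[of i x] by (metis add.assoc)
next
  case (step2 i)
  have "i - 1 + j = i + j - 1" by simp
  then show ?case
    using step2 zmul_minus_one[of "i + j" x] zmul_minus_one[of i x] by (metis add.assoc)
qed simp

lemma zmul_uminus: "zmul (- i) x = - zmul i x"
  using zmul_add[of "- i" i x] by (simp add: eq_neg_iff_add_eq_0)

lemma zmul_diff: "zmul (i - j) x = zmul i x - zmul j x"
  using zmul_add[of i "- j" x] by (simp add: zmul_uminus)

lemma zmul_mult: "zmul (i * j) x = zmul i (zmul j x)"
proof (induction i rule: int_induct[of _ 0])
  case (step1 i)
  have "(i + 1) * j = j + i * j" by (simp add: algebra_simps)
  then show ?case using zmul_add[of j "i * j" x] zmul_plus_one[of i "zmul j x"] step1 by metis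
next
  case (step2 i)
  have "(i - 1) * j = - j + i * j" by (simp add: algebra_simps)
  then show ?case
    using zmul_add[of "- j" "i * j" x] zmul_minus_one[of i "zmul j x"] zmul_uminus[of j x] step2 by metis
qed simp

lemma zmul_zero [simp]: "zmul i 0 = 0"
  using zmul_mult[of i 0 0] by simp

text \<open>The hypothesis says that conjugation by \<open>s\<close> takes \<open>t\<close> to
  \<open>t'\<close>; an automorphism takes multiples to multiples. Most of the torsion arguments
  below use conjugation in this form without subtraction.\<close>

lemma zmul_intertwine:
  assumes "s + t = t' + s"
  shows "s + zmul j t = zmul j t' + s"
proof (induction j rule: int_induct[of _ 0])
  case (step1 i)
  then show ?case by (metis add.assoc assms zmul_plus_one)
next
  case (step2 i)
  have "s + - t = - t' + s"
    using assms by (metis add.assoc add.right_neutral left_minus right_minus add_left_imp_eq add.left_neutral)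
  with step2 show ?case by (metis add.assoc zmul_minus_one)
qed simp

lemma zmul_commute: "s + t = t + s \<Longrightarrow> zmul i s + zmul j t = zmul j t + zmul i s"
  by (metis zmul_intertwine)

lemma torsion_free_zmul:
  fixes x :: "'a::group_add"
  assumes "torsion_free TYPE('a)" "zmul i x = 0"
  shows "i = 0 \<or> x = 0"
proof (rule ccontr)
  assume *: "\<not> ?thesis"
  have "((+) x ^^ nat \<bar>i\<bar>) 0 = 0"
    using assms(2) zmul_uminus[of i x] zmul_def[of "\<bar>i\<bar>" x] by (auto simp: abs_if split: if_splits)
  with assms(1) * show False unfolding torsion_free_def
    by (metis zero_less_abs_iff zero_less_nat_eq)
qed

text \<open>Used mainly in the product with the integers: \<open>gen {(x, a), (y, b)}\<close> is the
  graph of the would-be character with \<open>x\<close> of weight \<open>a\<close> and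
  \<open>y\<close> of weight \<open>b\<close>. It is single-valued exactly when
  \<open>(0, n)\<close> lies in it only for \<open>n = 0\<close>, so no presentation or quotient
  group has to be built.\<close>

inductive_set gen :: "'a::group_add set \<Rightarrow> 'a set" for S where
  zero: "0 \<in> gen S"
| plus: "s \<in> S \<Longrightarrow> g \<in> gen S \<Longrightarrow> s + g \<in> gen S"
| minus: "s \<in> S \<Longrightarrow> g \<in> gen S \<Longrightarrow> - s + g \<in> gen S"

lemma gen_add: "g \<in> gen S \<Longrightarrow> g' \<in> gen S \<Longrightarrow> g + g' \<in> gen S"
  by (induction rule: gen.induct) (auto simp: add.assoc intro: gen.intros)

lemma gen_base: "s \<in> S \<Longrightarrow> s \<in> gen S"
  using gen.plus[OF _ gen.zero, of s S] by simp

lemma gen_uminus: "g \<in> gen S \<Longrightarrow> - g \<in> gen S"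
proof (induction rule: gen.induct)
  case (plus s g)
  then show ?case
    using gen_add[OF plus.IH gen.minus[OF plus.hyps(1) gen.zero]] by (simp add: minus_add)
next
  case (minus s g)
  then show ?case
    using gen_add[OF minus.IH gen_base[OF minus.hyps(1)]] by (simp add: minus_add)
qed (simp add: gen.zero)

lemma gen_least: "S \<subseteq> gen T \<Longrightarrow> gen S \<subseteq> gen T"
proof
  fix g assume S: "S \<subseteq> gen T" "g \<in> gen S"
  from S(2,1) show "g \<in> gen T"
    by (induction rule: gen.induct) (auto intro: gen.zero gen_add gen_uminus)
qed

text \<open>
  Every \<open>(g, n)\<close> in the subgroup satisfies \<open>i s + g = j t + (i + n) s\<close> for all large \<open>i\<close> and suitable \<open>j\<close>;
  for \<open>g = 0\<close> this makes a multiple of \<open>t\<close> commute with \<open>s\<close>, hence vanish since \<open>k \<noteq> 1\<close>.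
\<close>

lemma BS_character:
  fixes s t :: "'a::group_add" and n :: int
  assumes tf: "torsion_free TYPE('a)" and s: "s \<noteq> 0" and k: "k \<noteq> 1"
    and rel: "s + t = zmul k t + s" and "(0, n) \<in> gen {(s, 1), (t, 0)}"
  shows "n = 0"
proof -
  have conj: "\<exists>j. zmul i s + zmul m t = zmul j t + zmul i s" if "i \<ge> 0" for i m
    using that
  proof (induction i arbitrary: m rule: int_ge_induct)
    case (step i)
    then obtain j where "zmul i s + zmul m t = zmul j t + zmul i s" by blast
    then have "zmul (i + 1) s + zmul m t = s + zmul j t + zmul i s"
      by (simp add: zmul_plus_one add.assoc)
    also have "\<dots> = zmul j (zmul k t) + zmul (i + 1) s"
      by (simp add: zmul_intertwine[OF rel] zmul_plus_one add.assoc)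
    finally show ?case by (metis zmul_mult)
  qed (auto intro: exI[of _ m])
  have nf: "\<exists>i0\<ge>0. \<forall>i\<ge>i0. \<exists>j. zmul i s + g = zmul j t + zmul (i + n) s"
    if "(g, n) \<in> gen {(s, 1), (t, 0)}" for g and n :: int
    using that
  proof (induction "(g, n)" arbitrary: g n rule: gen.induct)
    case zero
    then show ?case by (intro exI[of _ 0]) (auto simp: zero_prod_def intro: exI[of _ 0])
  next
    case (plus a b)
    obtain g' n' where b: "b = (g', n')" by fastforce
    with plus obtain i0 where i0: "i0 \<ge> 0" "\<And>i. i \<ge> i0 \<Longrightarrow> \<exists>j. zmul i s + g' = zmul j t + zmul (i + n') s"
      by blast
    consider "a = (s, 1)" | "a = (t, 0)" using plus by blast
    then show ?case
    proof cases
      case 1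
      then have "g = s + g'" "n = 1 + n'" using plus b by auto
      moreover have "zmul i s + (s + g') = zmul (i + 1) s + g'" for i
        by (simp add: zmul_add add.assoc)
      moreover have "i + 1 + n' = i + (1 + n')" for i by simp
      ultimately show ?thesis using i0
        by (intro exI[of _ i0]) (metis add_increasing2 zero_le_one add.commute)
    next
      case 2
      then have gn: "g = t + g'" "n = n'" using plus b by auto
      have "\<exists>j. zmul i s + (t + g') = zmul j t + zmul (i + n') s" if i: "i \<ge> i0" for i
      proof -
        obtain j where j: "zmul i s + g' = zmul j t + zmul (i + n') s" using i0(2) i by blast
        obtain l where l: "zmul i s + zmul 1 t = zmul l t + zmul i s"
          using conj[of i 1] i i0(1) by auto
        have "zmul i s + (t + g') = zmul l t + (zmul i s + g')"
          using l by (simp flip: add.assoc)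
        then show ?thesis unfolding j by (metis add.assoc zmul_add)
      qed
      then show ?thesis using i0(1) gn by blast
    qed
  next
    case (minus a b)
    obtain g' n' where b: "b = (g', n')" by fastforce
    with minus obtain i0 where i0: "i0 \<ge> 0" "\<And>i. i \<ge> i0 \<Longrightarrow> \<exists>j. zmul i s + g' = zmul j t + zmul (i + n') s"
      by blast
    consider "a = (s, 1)" | "a = (t, 0)" using minus by blast
    then show ?case
    proof cases
      case 1
      then have gn: "g = - s + g'" "n = n' - 1" using minus b by auto
      \<comment> \<open>The prefix \<open>- s\<close> uses up one of the \<open>i\<close> copies of
        \<open>s\<close>, so the threshold grows by one. No statement for all \<open>i\<close> is
        possible here, since \<open>conj\<close> moves multiples of \<open>t\<close> past
        \<open>s\<close> in one direction only.\<close>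
      have "\<exists>j. zmul i s + (- s + g') = zmul j t + zmul (i + (n' - 1)) s" if "i \<ge> i0 + 1" for i
      proof -
        have "zmul i s + - s = zmul (i - 1) s" by (simp add: zmul_diff)
        then have "zmul i s + (- s + g') = zmul (i - 1) s + g'" by (metis add.assoc)
        moreover have "i - 1 + n' = i + (n' - 1)" by simp
        ultimately show ?thesis using i0(2)[of "i - 1"] that by (metis le_diff_eq)
      qed
      then show ?thesis using gn i0(1) by (intro exI[of _ "i0 + 1"]) auto
    next
      case 2
      then have gn: "g = - t + g'" "n = n'" using minus b by auto
      have "\<exists>j. zmul i s + (- t + g') = zmul j t + zmul (i + n') s" if i: "i \<ge> i0" for i
      proof -
        obtain j where j: "zmul i s + g' = zmul j t + zmul (i + n') s" using i0(2) i by blast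
        obtain l where l: "zmul i s + zmul (- 1) t = zmul l t + zmul i s"
          using conj[of i "- 1"] i i0(1) by force
        then have "zmul i s + - t = zmul l t + zmul i s" by (simp add: zmul_uminus[of 1])
        then have "zmul i s + (- t + g') = zmul l t + (zmul i s + g')"
          by (metis add.assoc)
        then show ?thesis unfolding j by (metis add.assoc zmul_add)
      qed
      then show ?thesis using i0(1) gn by blast
    qed
  qed
  obtain i j where ij: "zmul i s = zmul j t + zmul (i + n) s"
    using nf[OF assms(5)] by auto
  then have j: "zmul j t = zmul (- n) s"
    by (metis add.commute add_diff_cancel add_diff_cancel_left' diff_minus_eq_add zmul_add zmul_diff uminus_add_conv_diff zmul_uminus)
  have "s + zmul j t = zmul j t + s"
    unfolding j using zmul_commute[of s s 1 "- n"] by simp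
  then have "zmul (j * k) t = zmul j t"
    using zmul_intertwine[OF rel, of j] by (simp add: zmul_mult)
  then have "zmul (j * k - j) t = 0" by (simp add: zmul_diff)
  then have "j * k - j = 0 \<or> t = 0" by (rule torsion_free_zmul[OF tf])
  then have "j * (k - 1) = 0 \<or> t = 0" by (simp add: right_diff_distrib)
  with k have "zmul j t = 0" by auto
  with j torsion_free_zmul[OF tf, of "- n" s] s show ?thesis by auto
qed

text \<open>If no relation \<open>zmul i s + zmul j t = 0\<close> has \<open>i \<noteq> 0\<close>,
  the exponent of \<open>s\<close> is a character. Otherwise the relation itself dictates the
  weights \<open>j\<close> for \<open>s\<close> and \<open>- i\<close> for \<open>t\<close>, which
  cancel on it.\<close>

lemma abelian_character:
  fixes s t :: "'a::group_add"
  assumes tf: "torsion_free TYPE('a)" and st: "s \<noteq> 0" and comm: "s + t = t + s"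
  obtains a b where "(a, b) \<noteq> (0, 0)" "\<And>n. (0, n) \<in> gen {(s, a), (t, b)} \<Longrightarrow> n = (0::int)"
proof -
  have nf: "\<exists>i j. g = zmul i s + zmul j t \<and> n = i * a + j * b"
    if "(g, n) \<in> gen {(s, a), (t, b)}" for g and n a b :: int
    using that
  proof (induction "(g, n)" arbitrary: g n rule: gen.induct)
    case zero
    then show ?case by (intro exI[of _ 0]) (auto simp: zero_prod_def)
  next
    case (plus x y)
    obtain g' n' where b: "y = (g', n')" by fastforce
    with plus obtain i j where ij: "g' = zmul i s + zmul j t" "n' = i * a + j * b"
      by blast
    consider "x = (s, a)" | "x = (t, b)" using plus by blast
    then show ?case
    proof cases
      case 1
      then show ?thesis using plus b ij
        by (intro exI[of _ "i + 1"] exI[of _ j]) (simp add: zmul_plus_one add.assoc distrib_right)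
    next
      case 2
      have "t + (zmul i s + zmul j t) = zmul i s + (t + zmul j t)"
        using zmul_commute[OF comm, of i 1] by (simp flip: add.assoc)
      with 2 show ?thesis using plus b ij
        by (intro exI[of _ i] exI[of _ "j + 1"]) (simp add: zmul_plus_one distrib_right)
    qed
  next
    case (minus x y)
    obtain g' n' where b: "y = (g', n')" by fastforce
    with minus obtain i j where ij: "g' = zmul i s + zmul j t" "n' = i * a + j * b"
      by blast
    consider "x = (s, a)" | "x = (t, b)" using minus by blast
    then show ?case
    proof cases
      case 1
      then show ?thesis using minus b ij
        by (intro exI[of _ "i - 1"] exI[of _ j]) (simp add: zmul_minus_one add.assoc left_diff_distrib)
    next
      case 2
      have "- t + (zmul i s + zmul j t) = zmul i s + (- t + zmul j t)"
        using zmul_commute[OF comm, of i "-1"] by (simp add: zmul_uminus flip: add.assoc)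
      with 2 show ?thesis using minus b ij
        by (intro exI[of _ i] exI[of _ "j - 1"]) (simp add: zmul_minus_one left_diff_distrib)
    qed
  qed
  show ?thesis
  proof (cases "\<exists>i j. i \<noteq> 0 \<and> zmul i s + zmul j t = 0")
    case False
    then show ?thesis using nf[of 0 _ 1 0] by (intro that[of 1 0]) force+
  next
    case True
    then obtain i j where ij: "i \<noteq> 0" "zmul i s + zmul j t = 0" by blast
    show ?thesis
    proof (rule that[of j "- i"])
      fix n assume "(0, n) \<in> gen {(s, j), (t, - i)}"
      then obtain a b where ab: "0 = zmul a s + zmul b t" "n = a * j - b * i"
        using nf[of 0 n j "- i"] by auto
      have "zmul b t = - zmul a s" using ab(1) by (metis add.inverse_unique)
      moreover have "zmul j t = - zmul i s" using ij(2) by (metis add.inverse_unique)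
      moreover have "zmul n t = zmul a (zmul j t) - zmul i (zmul b t)"
        unfolding ab(2) by (simp add: zmul_diff mult.commute[of b] flip: zmul_mult)
      ultimately have nt: "zmul n t = 0"
        by (metis add.inverse_neutral diff_self mult.commute mult_minus_right zmul_mult zmul_uminus)
      show "n = 0"
      proof (rule ccontr)
        assume "n \<noteq> 0"
        with nt tf have "t = 0" using torsion_free_zmul by blast
        with ij tf st show False using torsion_free_zmul[OF tf, of i s] by simp
      qed
    qed (use ij in auto)
  qed
qed

lemmas group_word_simps = minus_add add.assoc diff_conv_add_uminus minus_minus minus_zero
  add_0_left add_0_right left_minus right_minus add_minus_cancel minus_add_cancel

section \<open>Three-element supports with at most one unique product\<close>

text \<open>Otherwise \<open>T\<close> would contain \<open>b\<close>, \<open>d + b\<close>,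
  \<open>d + d + b\<close> and so on, all distinct because \<open>d\<close> has infinite
  order.\<close>

lemma finite_left_translate_escape:
  fixes d :: "'a::group_add"
  assumes tf: "torsion_free TYPE('a)" and T: "finite T" "T \<noteq> {}" and "d \<noteq> 0"
  obtains b where "b \<in> T" "d + b \<notin> T"
proof (rule ccontr)
  assume "\<not> thesis"
  with that have closed: "d + b \<in> T" if "b \<in> T" for b using that by blast
  obtain b where "b \<in> T" using T by blast
  have "zmul (int i) d + b \<in> T" for i
    by (induction i) (use closed \<open>b \<in> T\<close> in \<open>auto simp: zmul_plus_one add.assoc add.commute[of 1 "int _"]\<close>)
  then have "finite (range (\<lambda>i. zmul (int i) d + b))"
    using T(1) by (meson finite_subset image_subsetI)
  then obtain i j :: nat where "i \<noteq> j" "zmul (int i) d + b = zmul (int j) d + b"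
    by (metis (no_types, lifting) finite_imageD infinite_UNIV_nat injI)
  then have "zmul (int i - int j) d = 0" by (simp add: zmul_diff)
  with \<open>i \<noteq> j\<close> \<open>d \<noteq> 0\<close> show False using torsion_free_zmul[OF tf] by force
qed

text \<open>The group algebra enters only through \<open>unique_product_eq\<close>: a unique product
  has a nonzero coefficient in \<open>\<gamma> * \<delta>\<close>, and 1 has a single nonzero
  coefficient. Uniqueness asks just for \<open>a' = a\<close>, since \<open>b' = b\<close> then
  follows by cancellation.\<close>

locale three_by =
  fixes A B :: "'a::group_add set"
  assumes tf: "torsion_free TYPE('a)"
    and card_A: "card A = 3"
    and B: "finite B" "B \<noteq> {}"
    and unique_product_eq: "\<lbrakk>a \<in> A; b \<in> B; c \<in> A; d \<in> B;
      \<And>a' b'. \<lbrakk>a' \<in> A; b' \<in> B; a' + b' = a + b\<rbrakk> \<Longrightarrow> a' = a;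
      \<And>a' b'. \<lbrakk>a' \<in> A; b' \<in> B; a' + b' = c + d\<rbrakk> \<Longrightarrow> a' = c\<rbrakk> \<Longrightarrow> a = c \<and> b = d"
begin

lemma finite_A: "finite A" using card_A card.infinite by fastforce

text \<open>A product of the top layers \<open>M\<close> of \<open>A\<close> and \<open>T\<close> of
  \<open>B0\<close> can only be matched inside these layers. As \<open>c\<close> is not constant on
  three elements, \<open>M\<close> has one or two of them. For one, any \<open>b\<close> in
  \<open>T\<close> works; for two, a \<open>b\<close> whose translate by their difference leaves
  \<open>T\<close>.\<close>

lemma top_unique_product:
  fixes c N :: "'a \<Rightarrow> int"
  assumes B0: "B0 \<subseteq> B" "B0 \<noteq> {}"
    and lev: "\<And>a a' b b'. \<lbrakk>a \<in> A; a' \<in> A; b \<in> B0; b' \<in> B; a' + b' = a + b\<rbrakk>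
                \<Longrightarrow> b' \<in> B0 \<and> c a' + N b' = c a + N b"
    and nc: "u \<in> A" "v \<in> A" "c u \<noteq> c v"
  obtains a b where "a \<in> A" "b \<in> B" "\<And>a'. a' \<in> A \<Longrightarrow> c a' \<le> c a"
    "\<And>a' b'. \<lbrakk>a' \<in> A; b' \<in> B; a' + b' = a + b\<rbrakk> \<Longrightarrow> a' = a"
proof -
  define m where "m = Max (c ` A)"
  define l where "l = Max (N ` B0)"
  define M where "M = {a \<in> A. c a = m}"
  define T where "T = {b \<in> B0. N b = l}"
  have fin: "finite B0" using B0 B finite_subset by blast
  have m: "c a \<le> m" if "a \<in> A" for a using that finite_A by (simp add: m_def)
  have l: "N b \<le> l" if "b \<in> B0" for b using that fin by (simp add: l_def)
  have "m \<in> c ` A" unfolding m_def using finite_A nc by (intro Max_in) auto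
  then obtain a where a: "a \<in> M" by (auto simp: M_def)
  have "l \<in> N ` B0" unfolding l_def using fin B0 by (intro Max_in) auto
  then have T: "T \<noteq> {}" "finite T" "T \<subseteq> B0" using fin by (auto simp: T_def)
  have top: "a' \<in> M \<and> b' \<in> T" if "a \<in> M" "b \<in> T" "a' \<in> A" "b' \<in> B" "a' + b' = a + b" for a b a' b'
  proof -
    have "b' \<in> B0 \<and> c a' + N b' = m + l"
      using lev[of a a' b b'] that by (auto simp: M_def T_def)
    with m[of a'] l[of b'] that show ?thesis by (auto simp: M_def T_def)
  qed
  have aA: "a \<in> A" using a by (simp add: M_def)
  have amax: "c a' \<le> c a" if "a' \<in> A" for a'
    using a m[OF that] by (simp add: M_def)
  show ?thesis
  proof (cases "M = {a}")
    case True
    obtain b where "b \<in> T" using T by blast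
    then show ?thesis
    proof (intro that[OF aA _ amax])
      fix a' b' assume "a' \<in> A" "b' \<in> B" "a' + b' = a + b"
      then show "a' = a" using top[OF a \<open>b \<in> T\<close>] True by blast
    qed (use T B0 in blast)
  next
    case False
    then obtain a2 where a2: "a2 \<in> M" "a2 \<noteq> a" using a by blast
    have "M \<noteq> A"
    proof
      assume "M = A"
      then have "u \<in> M" "v \<in> M" using nc by simp_all
      with nc(3) show False by (simp add: M_def)
    qed
    then have "M \<subset> A" unfolding M_def by blast
    then have "card M < 3" using psubset_card_mono[OF finite_A] card_A by metis
    then have "card M \<le> 2" by simp
    moreover have "{a, a2} \<subseteq> M" "finite M" using a a2 finite_A by (auto simp: M_def)
    ultimately have M: "M = {a, a2}" using a2 card_seteq[of M "{a, a2}"] by simp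
    have "- a2 + a \<noteq> 0" using a2 by (metis add.right_neutral add_minus_cancel)
    then obtain b where b: "b \<in> T" "- a2 + a + b \<notin> T"
      using finite_left_translate_escape[OF tf T(2,1)] by blast
    have "a' = a" if "a' \<in> A" "b' \<in> B" "a' + b' = a + b" for a' b'
    proof (rule ccontr)
      assume "a' \<noteq> a"
      then have "a' = a2" "b' \<in> T" using top[OF a b(1) that] M by auto
      then have "b' = - a2 + a + b" using arg_cong[OF that(3), of "(+) (- a2)"] by (simp only: add.assoc minus_add_cancel)
      with b \<open>b' \<in> T\<close> show False by simp
    qed
    then show ?thesis by (intro that[OF aA _ amax]) (use b(1) T B0 in blast)+
  qed
qed

text \<open>The top layer and, after negating the grading, the bottom layer each hold a unique
  product. As these coincide, the same \<open>a\<close> is both maximal and minimal for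
  \<open>c\<close>, so \<open>c\<close> would be constant.\<close>

lemma graded_absurd:
  fixes c N :: "'a \<Rightarrow> int"
  assumes B0: "B0 \<subseteq> B" "B0 \<noteq> {}"
    and lev: "\<And>a a' b b'. \<lbrakk>a \<in> A; a' \<in> A; b \<in> B0; b' \<in> B; a' + b' = a + b\<rbrakk>
                \<Longrightarrow> b' \<in> B0 \<and> c a' + N b' = c a + N b"
    and nc: "u \<in> A" "v \<in> A" "c u \<noteq> c v"
  shows False
proof -
  obtain a b where ab: "a \<in> A" "b \<in> B" "\<And>a'. a' \<in> A \<Longrightarrow> c a' \<le> c a"
    "\<And>a' b'. \<lbrakk>a' \<in> A; b' \<in> B; a' + b' = a + b\<rbrakk> \<Longrightarrow> a' = a"
    using top_unique_product[of B0 c N, OF B0 lev nc] by blast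
  obtain a2 b2 where ab2: "a2 \<in> A" "b2 \<in> B" "\<And>a'. a' \<in> A \<Longrightarrow> - c a' \<le> - c a2"
    "\<And>a' b'. \<lbrakk>a' \<in> A; b' \<in> B; a' + b' = a2 + b2\<rbrakk> \<Longrightarrow> a' = a2"
  proof (rule top_unique_product[of B0 "\<lambda>a. - c a" "\<lambda>a. - N a", OF B0 _ nc(1,2)])
    show "b' \<in> B0 \<and> - c a' + - N b' = - c a + - N b"
      if "a \<in> A" "a' \<in> A" "b \<in> B0" "b' \<in> B" "a' + b' = a + b" for a a' b b'
      using lev[OF that] by simp
  qed (use nc in auto)
  have "a = a2 \<and> b = b2" by (rule unique_product_eq) (use ab ab2 in blast)+
  then have "c u = c a" "c v = c a" using nc ab(3) ab2(3) by (force intro: antisym)+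
  with nc show False by simp
qed

text \<open>The differences of \<open>A\<close> generate the domain of the character, and
  \<open>B0\<close> is the part of \<open>B\<close> in one right coset of it. Equal products differ
  by such a difference, so they stay in the coset and respect the grading \<open>N\<close>
  transported to it.\<close>

lemma character_absurd:
  fixes a b :: int
  assumes A: "{p, q, r} = A" and ab: "(a, b) \<noteq> (0, 0)"
    and char: "\<And>n. (0, n) \<in> gen {(- p + q, a), (- p + r, b)} \<Longrightarrow> n = 0"
  shows False
proof -
  define S where "S = {(- p + q, a), (- p + r, b)}"
  have dist: "p \<noteq> q" "p \<noteq> r" "q \<noteq> r" using card_A A by (auto simp: card_insert_if split: if_splits)
  define c where "c = (\<lambda>w. if w = p then 0 else if w = q then a else b)"
  have c: "(- p + w, c w) \<in> gen S" if "w \<in> A" for w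
    using that gen.zero[of S] unfolding A[symmetric] c_def S_def
    by (auto simp: zero_prod_def intro: gen_base)
  obtain g0 where g0: "g0 \<in> B" using B by blast
  define N where "N = (\<lambda>b. THE n. (b - g0, n) \<in> gen S)"
  have N: "N b = n" if "(b - g0, n) \<in> gen S" for b n
  proof -
    have "n' = n" if "(b - g0, n') \<in> gen S" for n'
      using gen_add[OF that gen_uminus[OF \<open>(b - g0, n) \<in> gen S\<close>]] char[of "n' - n"]
      by (simp add: S_def del: minus_diff_eq)
    then show ?thesis unfolding N_def using that by blast
  qed
  define B0 where "B0 = {b \<in> B. \<exists>n. (b - g0, n) \<in> gen S}"
  show False
  proof (rule graded_absurd[of B0 c N])
    show "B0 \<subseteq> B" by (auto simp: B0_def)
    have "(g0 - g0, 0) \<in> gen S" using gen.zero[of S] by (simp add: zero_prod_def)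
    with g0 show "B0 \<noteq> {}" unfolding B0_def by blast
    fix u u' w w' assume H: "u \<in> A" "u' \<in> A" "w \<in> B0" "w' \<in> B" "u' + w' = u + w"
    then obtain n where n: "(w - g0, n) \<in> gen S" by (auto simp: B0_def)
    have w': "w' = - u' + u + w" using arg_cong[OF H(5), of "(+) (- u')"] by (simp only: add.assoc minus_add_cancel)
    have "(- (- p + u') + (- p + u) + (w - g0), - c u' + c u + n) \<in> gen S"
      using gen_add[OF gen_add[OF gen_uminus[OF c[OF H(2)]] c[OF H(1)]] n] by simp
    moreover have "- (- p + u') + (- p + u) + (w - g0) = w' - g0"
      unfolding w' by (simp add: minus_add add.assoc flip: add_uminus_conv_diff)
    ultimately have "(w' - g0, - c u' + c u + n) \<in> gen S" by simp
    with N[OF this] N[OF n] H show "w' \<in> B0 \<and> c u' + N w' = c u + N w"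
      by (auto simp: B0_def)
  next
    show "p \<in> A" "(if a = 0 then r else q) \<in> A" "c p \<noteq> c (if a = 0 then r else q)"
      using A ab dist by (auto simp: c_def)
  qed
qed

text \<open>Allows the Baumslag-Solitar form to appear only after a change of generators:
  \<open>a\<close> and \<open>b\<close> are the weights of the two differences when \<open>s\<close>
  has weight 1 and \<open>t\<close> weight 0.\<close>

lemma BS_absurd:
  fixes a b :: int
  assumes A: "{p, q, r} = A" and "s \<noteq> 0" "k \<noteq> 1" "s + t = zmul k t + s"
    and "(- p + q, a) \<in> gen {(s, 1), (t, 0)}" "(- p + r, b) \<in> gen {(s, 1), (t, 0)}"
    and "(a, b) \<noteq> (0, 0)"
  shows False
proof (rule character_absurd[OF A assms(7)], goal_cases)
  case (1 n)
  with gen_least[of "{(- p + q, a), (- p + r, b)}"] assms(5,6)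
  have "(0, n) \<in> gen {(s, 1), (t, 0)}" by blast
  then show "n = 0" using BS_character[OF tf] assms by blast
qed

lemma abelian_absurd:
  assumes A: "{p, p + x, p + y} = A" and comm: "x + y = y + x"
  shows False
proof -
  have "x \<noteq> 0" using card_A A by (auto simp: card_insert_if split: if_splits)
  then obtain a b where "(a, b) \<noteq> (0, 0)" "\<And>n. (0, n) \<in> gen {(x, a), (y, b)} \<Longrightarrow> n = (0::int)"
    using abelian_character[OF tf _ comm] by metis
  then show False using character_absurd[OF A, of a b] by (simp flip: add.assoc)
qed

lemma BS_absurd_base:
  fixes a b :: int
  assumes A: "{p, p + x, p + y} = A" and "s \<noteq> 0" "k \<noteq> 1" "s + t = zmul k t + s"
    and "(x, a) \<in> gen {(s, 1), (t, 0)}" "(y, b) \<in> gen {(s, 1), (t, 0)}"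
    and "(a, b) \<noteq> (0, 0)"
  shows False
  using BS_absurd[OF A assms(2-4) _ _ assms(7)] assms(5,6) by (simp flip: add.assoc)

lemma cyclic_absurd:
  assumes A: "{p, p + x, p + zmul k x} = A"
  shows False
proof (rule abelian_absurd[OF A])
  show "x + zmul k x = zmul k x + x" using zmul_commute[of x x 1 k] by simp
qed

end

text \<open>
  An edge \<open>a + b = a' + c\<close> means \<open>c = (- a' + a) + b\<close>. Hence a closed walk whose edges use the pairs
  \<open>(a\<^sub>1, a\<^sub>1'), (a\<^sub>2, a\<^sub>2'), \<dots>\<close> yields \<open>alt [a\<^sub>1, a\<^sub>1', a\<^sub>2, a\<^sub>2', \<dots>] = 0\<close>.
\<close>

fun alt :: "'a::group_add list \<Rightarrow> 'a" where
  "alt (a # b # cs) = alt cs + (- b + a)"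
| "alt cs = 0"

lemmas word_simps = alt.simps group_word_simps

context three_by
begin

text \<open>Each difference \<open>- b + a\<close> in \<open>A\<close> is a word in \<open>x\<close>
  and \<open>y\<close>, so this substitution removes \<open>p\<close> from \<open>alt\<close> and
  leaves a short group word.\<close>

lemma base_point:
  assumes "{p, q, r} = A"
  obtains x y where "q = p + x" "r = p + y" "{p, p + x, p + y} = A" "x \<noteq> 0" "y \<noteq> 0" "x \<noteq> y"
proof -
  have dist: "p \<noteq> q" "p \<noteq> r" "q \<noteq> r" using card_A assms by (auto simp: card_insert_if split: if_splits)
  have "- p + q \<noteq> 0" "- p + r \<noteq> 0"
    using dist by (metis add.right_neutral add_minus_cancel)+
  with assms dist show ?thesis
    by (intro that[of "- p + q" "- p + r"]) (auto simp flip: add.assoc)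
qed

lemma torsion_free_2: "x + x = 0 \<Longrightarrow> x = (0::'a)"
  using torsion_free_zmul[OF tf, of 2 x] zmul_plus_one[of 1 x] by simp

lemma torsion_free_3: "x + (x + x) = 0 \<Longrightarrow> x = (0::'a)"
  using torsion_free_zmul[OF tf, of 3 x] zmul_plus_one[of 1 x] zmul_plus_one[of 2 x] by simp

lemma torsion_free_4: "x + (x + (x + x)) = 0 \<Longrightarrow> x = (0::'a)"
  using torsion_free_zmul[OF tf, of 4 x] zmul_plus_one[of 1 x] zmul_plus_one[of 2 x] zmul_plus_one[of 3 x]
  by simp

lemma zmul_consts: "zmul 2 x = x + x" "zmul (- 1) x = - x" "zmul (- 2) x = - x + - x"
  "zmul (- 3) x = - x + (- x + - x)" for x :: 'a
  using zmul_plus_one[of 1 x] zmul_plus_one[of 2 x] zmul_uminus[of 1 x] zmul_uminus[of 2 x] zmul_uminus[of 3 x]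
  by (simp_all add: minus_add add.assoc diff_conv_add_uminus del: add_uminus_conv_diff)

section \<open>Colour words whose relation is contradictory by itself\<close>

context
  fixes p q r assumes A: "{p, q, r} = A"
begin

text \<open>The digits in the following names encode the word, with 0, 1, 2 standing for \<open>p, q, r\<close>.\<close>

lemma no_0101: "alt [p, q, p, q] \<noteq> 0"
proof
  assume R: "alt [p, q, p, q] = 0"
  obtain x y where xy: "q = p + x" "r = p + y"
    and A': "{p, p + x, p + y} = A" and ne: "x \<noteq> 0" "y \<noteq> 0" "x \<noteq> y"
    using base_point[of p q r] A by blast
  have W: "- x + - x = 0"
    using R by (simp only: xy word_simps)
  show False using torsion_free_2[OF W] ne by simp
qed

lemma no_010101: "alt [p, q, p, q, p, q] \<noteq> 0"
proof
  assume R: "alt [p, q, p, q, p, q] = 0"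
  obtain x y where xy: "q = p + x" "r = p + y"
    and A': "{p, p + x, p + y} = A" and ne: "x \<noteq> 0" "y \<noteq> 0" "x \<noteq> y"
    using base_point[of p q r] A by blast
  have W: "- x + (- x + - x) = 0"
    using R by (simp only: xy word_simps)
  show False using torsion_free_3[OF W] ne by simp
qed

lemma no_01010101: "alt [p, q, p, q, p, q, p, q] \<noteq> 0"
proof
  assume R: "alt [p, q, p, q, p, q, p, q] = 0"
  obtain x y where xy: "q = p + x" "r = p + y"
    and A': "{p, p + x, p + y} = A" and ne: "x \<noteq> 0" "y \<noteq> 0" "x \<noteq> y"
    using base_point[of p q r] A by blast
  have W: "- x + (- x + (- x + - x)) = 0"
    using R by (simp only: xy word_simps)
  show False using torsion_free_4[OF W] ne by simp
qed

lemma no_0102: "alt [p, q, p, r] \<noteq> 0"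
proof
  assume R: "alt [p, q, p, r] = 0"
  obtain x y where xy: "q = p + x" "r = p + y"
    and A': "{p, p + x, p + y} = A" and ne: "x \<noteq> 0" "y \<noteq> 0" "x \<noteq> y"
    using base_point[of p q r] A by blast
  have W: "- y + - x = 0"
    using R by (simp only: xy word_simps)
  have "y = zmul (- 1) x"
    using arg_cong[OF W, of "\<lambda>w. y + w"] by (simp only: word_simps zmul_consts)
  with A' show False using cyclic_absurd by blast
qed

lemma no_010102: "alt [p, q, p, q, p, r] \<noteq> 0"
proof
  assume R: "alt [p, q, p, q, p, r] = 0"
  obtain x y where xy: "q = p + x" "r = p + y"
    and A': "{p, p + x, p + y} = A" and ne: "x \<noteq> 0" "y \<noteq> 0" "x \<noteq> y"
    using base_point[of p q r] A by blast
  have W: "- y + (- x + - x) = 0"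
    using R by (simp only: xy word_simps)
  have "y = zmul (- 2) x"
    using arg_cong[OF W, of "\<lambda>w. y + w"] by (simp only: word_simps zmul_consts)
  with A' show False using cyclic_absurd by blast
qed

lemma no_01010102: "alt [p, q, p, q, p, q, p, r] \<noteq> 0"
proof
  assume R: "alt [p, q, p, q, p, q, p, r] = 0"
  obtain x y where xy: "q = p + x" "r = p + y"
    and A': "{p, p + x, p + y} = A" and ne: "x \<noteq> 0" "y \<noteq> 0" "x \<noteq> y"
    using base_point[of p q r] A by blast
  have W: "- y + (- x + (- x + - x)) = 0"
    using R by (simp only: xy word_simps)
  have "y = zmul (- 3) x"
    using arg_cong[OF W, of "\<lambda>w. y + w"] by (simp only: word_simps zmul_consts)
  with A' show False using cyclic_absurd by blast
qed

lemma no_01020102: "alt [p, q, p, r, p, q, p, r] \<noteq> 0"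
proof
  assume R: "alt [p, q, p, r, p, q, p, r] = 0"
  obtain x y where xy: "q = p + x" "r = p + y"
    and A': "{p, p + x, p + y} = A" and ne: "x \<noteq> 0" "y \<noteq> 0" "x \<noteq> y"
    using base_point[of p q r] A by blast
  have W: "- y + (- x + (- y + - x)) = 0"
    using R by (simp only: xy word_simps)
  have W2: "- y + - x = 0" using torsion_free_2[of "- y + - x"] W by (simp only: add.assoc)
  have "y = zmul (- 1) x"
    using arg_cong[OF W2, of "\<lambda>w. y + w"] by (simp only: word_simps zmul_consts)
  with A' show False using cyclic_absurd by blast
qed

lemma no_012012: "alt [p, q, r, p, q, r] \<noteq> 0"
proof
  assume R: "alt [p, q, r, p, q, r] = 0"
  obtain x y where xy: "q = p + x" "r = p + y"
    and A': "{p, p + x, p + y} = A" and ne: "x \<noteq> 0" "y \<noteq> 0" "x \<noteq> y"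
    using base_point[of p q r] A by blast
  have W: "- y + (x + (y + - x)) = 0"
    using R by (simp only: xy word_simps)
  have "x + y = y + x" using arg_cong[OF W, of "\<lambda>w. y + (w + x)"] by (simp only: word_simps)
  with A' show False using abelian_absurd by blast
qed

text \<open>The relation of the Klein bottle group: \<open>x\<close> conjugates \<open>- y\<close>
  to its inverse.\<close>

lemma no_010212: "alt [p, q, p, r, q, r] \<noteq> 0"
proof
  assume R: "alt [p, q, p, r, q, r] = 0"
  obtain x y where xy: "q = p + x" "r = p + y"
    and A': "{p, p + x, p + y} = A" and ne: "x \<noteq> 0" "y \<noteq> 0" "x \<noteq> y"
    using base_point[of p q r] A by blast
  have W: "- y + (x + (- y + - x)) = 0"
    using R by (simp only: xy word_simps)
  have "x + (- y) = zmul (- 1) (- y) + x"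
    using arg_cong[OF W, of "\<lambda>w. y + (w + x)"] by (simp only: word_simps zmul_consts)
  moreover have "(x, 1) \<in> gen {(x, 1), ((- y), 0)}" "(y, 0) \<in> gen {(x, 1), ((- y), 0)}"
    using gen_base[of "(x, 1)" "{(x, 1), (- y, 0)}"] gen_uminus[OF gen_base[of "(- y, 0)" "{(x, 1), (- y, 0)}"]]
    by auto
  ultimately show False using BS_absurd_base[OF A', of "x" "(- 1)" "(- y)" "1" "0"] ne by simp
qed

text \<open>Here \<open>x + x + y + y = 0\<close>, again the Klein bottle group, visible in the
  generators \<open>x\<close> and \<open>x + y\<close>: conjugation by \<open>x\<close> negates
  \<open>x + y\<close>.\<close>

lemma no_01010202: "alt [p, q, p, q, p, r, p, r] \<noteq> 0"
proof
  assume R: "alt [p, q, p, q, p, r, p, r] = 0"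
  obtain x y where xy: "q = p + x" "r = p + y"
    and A': "{p, p + x, p + y} = A" and ne: "x \<noteq> 0" "y \<noteq> 0" "x \<noteq> y"
    using base_point[of p q r] A by blast
  have W: "- y + (- y + (- x + - x)) = 0"
    using R by (simp only: xy word_simps)
  have "x + (x + y) = zmul (- 1) (x + y) + x"
    using arg_cong[OF W, of "\<lambda>w. - w + - y"] by (simp only: word_simps zmul_consts)
  moreover have "(x, 1) \<in> gen {(x, 1), ((x + y), 0)}" "(y, (- 1)) \<in> gen {(x, 1), ((x + y), 0)}"
    using gen_base[of "(x, 1)" "{(x, 1), (x + y, 0)}"] gen.minus[of "(x, 1)" "{(x, 1), (x + y, 0)}", OF _ gen_base[of "(x + y, 0)"]]
    by auto
  ultimately show False using BS_absurd_base[OF A', of "x" "(- 1)" "(x + y)" "1" "(- 1)"] ne by simp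
qed

text \<open>In this and the next three words, conjugation by one generator or its negative
  multiplies the other generator by 2 or - 2.\<close>

lemma no_01012012: "alt [p, q, p, q, r, p, q, r] \<noteq> 0"
proof
  assume R: "alt [p, q, p, q, r, p, q, r] = 0"
  obtain x y where xy: "q = p + x" "r = p + y"
    and A': "{p, p + x, p + y} = A" and ne: "x \<noteq> 0" "y \<noteq> 0" "x \<noteq> y"
    using base_point[of p q r] A by blast
  have W: "- y + (x + (y + (- x + - x))) = 0"
    using R by (simp only: xy word_simps)
  have "(- y) + x = zmul 2 x + (- y)"
    using arg_cong[OF W, of "\<lambda>w. w + (x + (x + - y))"] by (simp only: word_simps zmul_consts)
  moreover have "(x, 0) \<in> gen {((- y), 1), (x, 0)}" "(y, (- 1)) \<in> gen {((- y), 1), (x, 0)}"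
    using gen_base[of "(x, 0)" "{(- y, 1), (x, 0)}"] gen_uminus[OF gen_base[of "(- y, 1)" "{(- y, 1), (x, 0)}"]]
    by auto
  ultimately show False using BS_absurd_base[OF A', of "(- y)" "2" "x" "0" "(- 1)"] ne by simp
qed

lemma no_01012102: "alt [p, q, p, q, r, q, p, r] \<noteq> 0"
proof
  assume R: "alt [p, q, p, q, r, q, p, r] = 0"
  obtain x y where xy: "q = p + x" "r = p + y"
    and A': "{p, p + x, p + y} = A" and ne: "x \<noteq> 0" "y \<noteq> 0" "x \<noteq> y"
    using base_point[of p q r] A by blast
  have W: "- y + (- x + (y + (- x + - x))) = 0"
    using R by (simp only: xy word_simps)
  have "(- y) + x = zmul (- 2) x + (- y)"
    using arg_cong[OF W, of "\<lambda>w. - x + (- x + (- w + - y))"] by (simp only: word_simps zmul_consts)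
  moreover have "(x, 0) \<in> gen {((- y), 1), (x, 0)}" "(y, (- 1)) \<in> gen {((- y), 1), (x, 0)}"
    using gen_base[of "(x, 0)" "{(- y, 1), (x, 0)}"] gen_uminus[OF gen_base[of "(- y, 1)" "{(- y, 1), (x, 0)}"]]
    by auto
  ultimately show False using BS_absurd_base[OF A', of "(- y)" "(- 2)" "x" "0" "(- 1)"] ne by simp
qed

lemma no_01020121: "alt [p, q, p, r, p, q, r, q] \<noteq> 0"
proof
  assume R: "alt [p, q, p, r, p, q, r, q] = 0"
  obtain x y where xy: "r = q + x" "p = q + y"
    and A': "{q, q + x, q + y} = A" and ne: "x \<noteq> 0" "y \<noteq> 0" "x \<noteq> y"
    using base_point[of q r p] A by blast
  have W: "x + (y + (- x + (y + y))) = 0"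
    using R by (simp only: xy word_simps)
  have "x + y = zmul (- 2) y + x"
    using arg_cong[OF W, of "\<lambda>w. w + (- y + (- y + x))"] by (simp only: word_simps zmul_consts)
  moreover have "(x, 1) \<in> gen {(x, 1), (y, 0)}" "(y, 0) \<in> gen {(x, 1), (y, 0)}"
    using gen_base[of "(x, 1)" "{(x, 1), (y, 0)}"] gen_base[of "(y, 0)" "{(x, 1), (y, 0)}"]
    by auto
  ultimately show False using BS_absurd_base[OF A', of "x" "(- 2)" "y" "1" "0"] ne by simp
qed

lemma no_01021021: "alt [p, q, p, r, q, p, r, q] \<noteq> 0"
proof
  assume R: "alt [p, q, p, r, q, p, r, q] = 0"
  obtain x y where xy: "q = p + x" "r = p + y"
    and A': "{p, p + x, p + y} = A" and ne: "x \<noteq> 0" "y \<noteq> 0" "x \<noteq> y"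
    using base_point[of p q r] A by blast
  have W: "- x + (y + (x + (- y + - x))) = 0"
    using R by (simp only: xy word_simps)
  have "y + x = zmul 2 x + y"
    using arg_cong[OF W, of "\<lambda>w. x + (w + (x + y))"] by (simp only: word_simps zmul_consts)
  moreover have "(x, 0) \<in> gen {(y, 1), (x, 0)}" "(y, 1) \<in> gen {(y, 1), (x, 0)}"
    using gen_base[of "(y, 1)" "{(y, 1), (x, 0)}"] gen_base[of "(x, 0)" "{(y, 1), (x, 0)}"]
    by auto
  ultimately show False using BS_absurd_base[OF A', of "y" "2" "x" "0" "1"] ne by simp
qed

end
end

section \<open>Trefoil relations and the classification of short cycles\<close>

lemma zmul_numeral_unfold: "zmul 2 x = x + x" "zmul 3 x = x + (x + x)"
  using zmul_plus_one[of 1 x] zmul_plus_one[of 2 x] by simp_all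

lemma commute_uminus:
  fixes z x :: "'a::group_add"
  assumes "x + z = z + x"
  shows "- x + z = z + - x"
  using arg_cong[OF assms, of "\<lambda>w. - x + (w + - x)"] by (simp only: group_word_simps)

lemma commute_add:
  fixes z :: "'a::group_add"
  assumes "u + z = z + u" "v + z = z + v"
  shows "u + v + z = z + (u + v)"
proof -
  have "u + v + z = u + (v + z)" by (simp only: add.assoc)
  also have "\<dots> = (u + z) + v" by (simp only: assms(2) add.assoc)
  also have "\<dots> = z + (u + v)" by (simp only: assms(1) add.assoc)
  finally show ?thesis .
qed

lemma double_central:
  fixes z :: "'a::group_add"
  assumes "u + z = z + u"
  shows "zmul 2 (z + u) = z + (z + (u + u))"
proof -
  have "zmul 2 (z + u) = z + ((u + z) + u)" by (simp only: zmul_numeral_unfold add.assoc)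
  also have "\<dots> = z + (z + (u + u))" by (simp only: assms add.assoc)
  finally show ?thesis .
qed

section \<open>Pairs of trefoil relations that force torsion\<close>

locale trefoil =
  fixes x y :: "'a::group_add"
  assumes tf: "torsion_free TYPE('a)" and x: "x \<noteq> 0" and y: "y \<noteq> 0"
begin

lemma zmul_eqD: "zmul i x = zmul j x \<Longrightarrow> i = j"
  using torsion_free_zmul[OF tf, of "i - j" x] x by (simp add: zmul_diff)

text \<open>The two relations together make \<open>y\<close> conjugate \<open>zmul 2 x\<close> to
  \<open>zmul 4 x\<close>, hence \<open>zmul 6 x\<close> to \<open>zmul 12 x\<close>. But
  \<open>zmul 6 x\<close> is a multiple of \<open>y\<close> and is fixed.\<close>

lemma clash_cube_sandwich:
  assumes 1: "y + y = x + (x + x)" and 2: "x + x = y + (x + y)"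
  shows False
proof -
  have "y + (x + x) = (y + y) + (x + y)" by (simp only: 2 add.assoc)
  also have "\<dots> = x + (x + x) + (x + y)" by (simp only: 1)
  also have "\<dots> = zmul 4 x + y"
    using zmul_plus_one[of 3 x] by (simp add: zmul_numeral_unfold add.assoc)
  finally have "y + zmul 3 (zmul 2 x) = zmul 3 (zmul 4 x) + y"
    by (intro zmul_intertwine) (simp add: zmul_numeral_unfold)
  then have "y + zmul 2 (zmul 3 x) = zmul 12 x + y"
    by (simp flip: zmul_mult)
  moreover have "y + zmul 2 (y + y) = zmul 2 (y + y) + y"
    by (simp add: zmul_numeral_unfold add.assoc)
  ultimately have "zmul 2 (zmul 3 x) = zmul 12 x"
    using 1 by (simp add: zmul_numeral_unfold)
  then show False using zmul_eqD[of 6 12] by (simp flip: zmul_mult)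
qed

lemma clash_cubes:
  assumes 1: "y + y = x + (x + x)" and 2: "y + (y + y) = x + x"
  shows False
proof -
  have "zmul 3 (zmul 2 y) = zmul 2 (zmul 3 y)" by (simp flip: zmul_mult)
  then have "zmul 3 (zmul 3 x) = zmul 2 (zmul 2 x)"
    using 1 2 by (simp add: zmul_numeral_unfold)
  then show False using zmul_eqD[of 9 4] by (simp flip: zmul_mult)
qed

text \<open>
  The conjugates \<open>k, k1, k2\<close> of \<open>k\<close> by powers of \<open>x\<close> satisfy quaternion relations up to the central
  element \<open>z\<close>, whence \<open>2 z = 0\<close>.
\<close>

lemma clash_quaternion:
  assumes 1: "k + k = x + (x + x)" and 2: "k + (- x + k) = x + (k + x)"
  shows False
proof -
  define z where "z = x + (x + x)"
  define k1 where "k1 = - x + (k + x)"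
  define k2 where "k2 = - x + (k1 + x)"
  have xz: "x + z = z + x" by (simp add: z_def add.assoc)
  have kz: "k + z = z + k" by (simp add: z_def add.assoc flip: 1)
  note comm = xz kz commute_uminus[OF xz] commute_uminus[OF kz]
  have kk: "k + k = z" using 1 z_def by simp
  have cyc: "- x + (k2 + x) = k"
  proof -
    have "- x + (k2 + x) = - z + (k + z)" by (simp only: k2_def k1_def z_def group_word_simps)
    then show ?thesis by (simp only: kz minus_add_cancel)
  qed
  have k1z: "k1 + z = z + k1" unfolding k1_def by (intro commute_add comm)
  have k2z: "k2 + z = z + k2" unfolding k2_def by (intro commute_add comm k1z)
  have e0: "k + k1 = z + k2"
    using arg_cong[OF 2, of "\<lambda>w. w + x"] by (simp only: k2_def k1_def z_def group_word_simps)
  have e1: "k1 + k2 = z + k"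
  proof -
    have "k1 + k2 = - x + ((k + k1) + x)" by (simp only: k2_def k1_def group_word_simps)
    also have "\<dots> = - x + z + (k2 + x)" by (simp only: e0 add.assoc)
    also have "\<dots> = z + (- x + (k2 + x))" by (simp only: comm add.assoc)
    finally show ?thesis by (simp only: cyc)
  qed
  have e2: "k2 + k = z + k1"
  proof -
    have "k2 + k = - x + ((k1 + k2) + x)" unfolding cyc[symmetric] by (simp only: k2_def group_word_simps)
    also have "\<dots> = - x + z + (k + x)" by (simp only: e1 add.assoc)
    also have "\<dots> = z + k1" by (simp only: comm add.assoc k1_def)
    finally show ?thesis .
  qed
  have "k2 + k = (z + k) + k2"
  proof -
    have "k + (k2 + k) = k + z + k1" by (simp only: e2 add.assoc)
    also have "\<dots> = z + (k + k1)" by (simp only: kz add.assoc)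
    also have "\<dots> = z + (z + k2)" by (simp only: e0)
    finally have e3: "k + (k2 + k) = z + (z + k2)" .
    have "z + (k2 + k) = k + (k + (k2 + k))" by (simp only: kk[symmetric] add.assoc)
    also have "\<dots> = (k + z) + (z + k2)" by (simp only: e3 add.assoc)
    also have "\<dots> = (z + k) + (z + k2)" by (simp only: kz)
    also have "\<dots> = z + ((k + z) + k2)" by (simp only: add.assoc)
    finally have "z + (k2 + k) = z + ((z + k) + k2)" by (simp only: kz)
    then show ?thesis by simp
  qed
  \<comment> \<open>Now \<open>k2\<close> conjugates \<open>k\<close> to \<open>z + k\<close>, hence
    \<open>z = k + k\<close> to \<open>z + (z + z)\<close>; but \<open>z\<close> commutes with
    \<open>k2\<close>.\<close>
  then have "k2 + zmul 2 k = zmul 2 (z + k) + k2" by (rule zmul_intertwine)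
  moreover have "zmul 2 (z + k) = z + (z + z)"
    using double_central[OF kz] kk by simp
  ultimately have "z + k2 = z + (z + z) + k2" by (simp only: zmul_numeral_unfold kk k2z)
  then have "z = z + (z + z)" by (rule add_right_imp_eq)
  then have "zmul 2 z = 0" using add_left_imp_eq[of z "z + z" 0] by (simp add: zmul_numeral_unfold)
  then have "zmul 2 (zmul 3 x) = 0" by (simp add: zmul_numeral_unfold z_def)
  then show False using zmul_eqD[of 6 0] by (simp flip: zmul_mult)
qed

text \<open>With \<open>k = x + y\<close>, the first relation becomes
  \<open>k + k = x + (x + x)\<close>, and the second the twisted one of the quaternion case.\<close>

lemma clash_sandwiches:
  assumes 1: "x + x = y + (x + y)" and 2: "y + y = x + (y + x)"
  shows False
proof (rule clash_quaternion[of "x + y"])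
  show "(x + y) + (x + y) = x + (x + x)" by (simp only: 1 add.assoc)
  show "x + y + (- x + (x + y)) = x + (x + y + x)" by (simp only: 2 add.assoc minus_add_cancel)
qed

text \<open>The element \<open>w\<close> conjugates \<open>x\<close> to \<open>- t\<close>, hence
  \<open>zmul 2 x\<close> to \<open>- z\<close>. As \<open>z\<close> is both \<open>t + t\<close>
  and \<open>zmul 3 x\<close>, it commutes with \<open>w\<close>, and
  \<open>zmul 2 x = - zmul 3 x\<close>.\<close>

lemma clash_sandwich_palindrome:
  assumes 1: "x + x = y + (x + y)" and 2: "y = x + (y + (y + x))"
  shows False
proof -
  define t where "t = y + x"
  define z where "z = x + (x + x)"
  define w where "w = - x + t"
  have tt: "t + t = z"
  proof -
    have "t + t = (y + (x + y)) + x" by (simp only: t_def add.assoc)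
    also have "\<dots> = x + x + x" by (simp only: 1)
    finally show ?thesis by (simp only: z_def add.assoc)
  qed
  have yt: "t = x + (y + t) + x" using arg_cong[OF 2, of "\<lambda>w. w + x"] unfolding t_def add.assoc .
  have y: "y = t + - x" by (simp only: t_def group_word_simps)
  have "t = x + ((t + - x) + t) + x" by (subst y[symmetric]) (rule yt)
  then have "t = x + (t + (- x + (t + x)))" by (simp only: add.assoc)
  from arg_cong[OF this, of "\<lambda>u. - t + (- x + u)"]
  have wx: "w + x = - t + w" by (simp only: w_def group_word_simps)
  have xz: "x + z = z + x" by (simp add: z_def add.assoc)
  have tz: "t + z = z + t" by (simp add: add.assoc flip: tt)
  have wz: "w + z = z + w" unfolding w_def by (intro commute_add commute_uminus xz tz)
  have "w + zmul 2 x = zmul 2 (- t) + w" by (rule zmul_intertwine[OF wx])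
  also have "zmul 2 (- t) = - z" by (simp only: zmul_numeral_unfold minus_add flip: tt)
  also have "- z + w = w + - z" using commute_uminus[of z w] wz by simp
  finally have "zmul 2 x = - z" by (rule add_left_imp_eq)
  then have "zmul 2 x = - zmul 3 x" by (simp only: zmul_numeral_unfold z_def)
  then show False using zmul_eqD[of 2 "- 3"] by (simp add: zmul_uminus)
qed

text \<open>Being both a multiple of \<open>x\<close> and a multiple of \<open>y\<close>,
  \<open>z\<close> is central; so the conjugate \<open>x2\<close> of \<open>x\<close> by
  \<open>y\<close> has the same double \<open>z\<close>.\<close>

lemma conj_of_square_eq_cube:

  assumes "y + (y + y) = x + x"
  defines "z \<equiv> x + x" and "x2 \<equiv> y + (x + - y)"
  shows "x + z = z + x" "y + z = z + y" "- x = - z + x" "x2 + x2 = z" "x2 + y = y + x" "x2 + z = z + x2"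
proof -
  show xz: "x + z = z + x" by (simp only: z_def add.assoc)
  show yz: "y + z = z + y" by (simp only: z_def add.assoc flip: assms(1))
  show "- x = - z + x" "x2 + y = y + x" unfolding z_def x2_def by (simp_all only: group_word_simps)
  have "x2 + x2 = y + (z + - y)" by (simp only: x2_def z_def group_word_simps)
  also have "\<dots> = (z + y) + - y" by (simp only: yz[symmetric] add.assoc)
  also have "\<dots> = z" by (simp only: group_word_simps)
  finally show "x2 + x2 = z" .
  then show "x2 + z = z + x2" by (simp only: add.assoc flip: \<open>x2 + x2 = z\<close>)
qed

text \<open>Trading \<open>x\<close> for \<open>z + - x\<close> lets the second relation apply and
  shows that \<open>x2\<close> conjugates \<open>y\<close> to \<open>z + x\<close>. Doubling gives
  \<open>zmul 2 y = zmul 3 z\<close>, while \<open>z = zmul 3 y\<close>.\<close>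

lemma clash_square_twist:
  assumes 1: "y + (y + y) = x + x" and 2: "y + (- x + y) = x + (y + x)"
  shows False
proof -
  define z where "z = x + x"
  define x2 where "x2 = y + (x + - y)"
  note a = conj_of_square_eq_cube[OF 1, folded z_def x2_def]
  have "x2 + (y + y) = y + x + y" by (simp only: a(5) flip: add.assoc)
  also have "x = z + - x" by (simp only: z_def group_word_simps)
  also have "y + (z + - x) + y = (y + z) + (- x + y)" by (simp only: add.assoc)
  also have "\<dots> = z + (y + (- x + y))" by (simp only: a(2) add.assoc)
  also have "\<dots> = z + (x + (y + x))" by (simp only: 2)
  also have "\<dots> = z + (x + (x2 + y))" by (simp only: a(5))
  finally have "x2 + y + y = (z + x) + x2 + y" by (simp only: add.assoc)
  then have "x2 + y = (z + x) + x2" by simp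
  then have "x2 + zmul 2 y = zmul 2 (z + x) + x2" by (rule zmul_intertwine)
  also have "zmul 2 (z + x) = zmul 3 z" by (simp only: double_central[OF a(1)] zmul_numeral_unfold(2) flip: z_def)
  also have "zmul 3 z + x2 = x2 + zmul 3 z"
    using zmul_intertwine[OF a(6), of 3] by simp
  finally have "zmul 2 y = zmul 3 z" by (rule add_left_imp_eq)
  moreover have "z = zmul 3 y" by (simp only: zmul_numeral_unfold z_def 1)
  ultimately have "zmul 2 y = zmul 3 (zmul 3 y)" by simp
  then have "zmul 2 y = zmul 9 y" by (simp flip: zmul_mult)
  then have "zmul (2 - 9) y = 0" by (simp only: zmul_diff diff_self)
  then show False using torsion_free_zmul[OF tf, of "2 - 9" y] y by simp
qed

text \<open>Conjugation by \<open>y\<close> permutes \<open>x2\<close>, \<open>x\<close>,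
  \<open>x1\<close> cyclically, because its cube is conjugation by the central \<open>z\<close>. It
  fixes \<open>y + y\<close>, so one expression for \<open>y + y\<close> yields the three rotated
  ones; multiplying them gives \<open>zmul 4 z = 0\<close>.\<close>

lemma clash_square_palindrome:
  assumes 1: "y + (y + y) = x + x" and 2: "y = x + (y + (y + x))"
  shows False
proof -
  define z where "z = x + x"
  define x2 where "x2 = y + (x + - y)"
  define x1 where "x1 = - y + (x + y)"
  note a = conj_of_square_eq_cube[OF 1, folded z_def x2_def]
  have x1: "y + x1 = x + y" by (simp add: x1_def)
  have yyy: "y + (y + y) = z" using 1 z_def by simp
  have x1z: "x1 + z = z + x1" unfolding x1_def by (intro commute_add commute_uminus a(1,2))
  note comm = a(1,2,6) x1z
  have x11: "x1 + x1 = z"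
  proof -
    have "y + (x1 + x1) = (y + x1) + x1" by (simp only: add.assoc)
    also have "\<dots> = x + (y + x1)" by (simp only: x1 add.assoc)
    also have "\<dots> = z + y" by (simp only: x1 z_def add.assoc)
    finally show ?thesis by (simp flip: a(2))
  qed
  have x12: "y + x2 = x1 + y"
  proof -
    have "y + (y + (y + x2)) = (y + (y + y)) + x2" by (simp only: add.assoc)
    also have "\<dots> = x2 + (y + (y + y))" by (simp only: yyy a)
    also have "\<dots> = (x2 + y) + (y + y)" by (simp only: add.assoc)
    also have "\<dots> = y + ((x + y) + y)" by (simp only: a(5) add.assoc)
    also have "\<dots> = y + (y + (x1 + y))" by (simp only: x1[symmetric] add.assoc)
    finally show ?thesis by simp
  qed
  have y1: "y + y = z + x2 + x"
  proof -
    have "y + y = - x + (y + - x)" using arg_cong[OF 2, of "\<lambda>w. - x + (w + - x)"] by (simp only: group_word_simps)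
    then have "(y + y) + y = (- x + (y + - x)) + y" by (simp only:)
    then have "- x + (y + (- x + y)) = z" by (simp only: yyy add.assoc)
    then have "x + z = y + (- x + y)" by (metis add_minus_cancel)
    also have "\<dots> = y + (- z + (x + y))" by (simp only: a(3) add.assoc)
    also have "\<dots> = - z + (y + (x + y))"
      by (simp only: commute_uminus[OF a(2)[symmetric]] flip: add.assoc)
    also have "\<dots> = - z + ((x2 + y) + y)" by (simp only: a(5) add.assoc)
    finally have "x2 + (y + y) = z + (x + z)" by (simp add: add.assoc)
    have "z + (y + y) = x2 + (x2 + (y + y))" by (simp only: add.assoc flip: a(4))
    also have "\<dots> = (x2 + z) + (x + z)" by (simp only: \<open>x2 + (y + y) = z + (x + z)\<close> add.assoc)
    also have "\<dots> = (z + x2) + (z + x)" by (simp only: a(1,6))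
    also have "\<dots> = z + ((x2 + z) + x)" by (simp only: add.assoc)
    also have "\<dots> = z + (z + x2 + x)" by (simp only: a(6))
    finally show ?thesis by simp
  qed
  have y2: "y + y = z + x + x1"
  proof -
    have "y + (y + y) = (y + y) + y" by (simp only: add.assoc)
    also have "\<dots> = (z + x2 + x) + y" by (simp only: y1)
    also have "\<dots> = z + ((x2 + y) + x1)" by (simp only: x1[symmetric] add.assoc)
    also have "\<dots> = (z + y) + (x + x1)" by (simp only: a(5) add.assoc)
    also have "\<dots> = y + (z + x + x1)" by (simp only: a(2)[symmetric] add.assoc)
    finally show ?thesis by simp
  qed
  have y3: "y + y = z + x1 + x2"
  proof -
    have "y + (y + y) = (y + y) + y" by (simp only: add.assoc)
    also have "\<dots> = (z + x + x1) + y" by (simp only: y2)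
    also have "\<dots> = z + ((x + y) + x2)" by (simp only: x12[symmetric] add.assoc)
    also have "\<dots> = (z + y) + (x1 + x2)" by (simp only: x1[symmetric] add.assoc)
    also have "\<dots> = y + (z + x1 + x2)" by (simp only: a(2)[symmetric] add.assoc)
    finally show ?thesis by simp
  qed
  have "z + y = (y + y) + (y + y)" by (simp only: yyy[symmetric] add.assoc)
  also have "\<dots> = (z + x2 + x) + (z + x + x1)" using y1 y2 by simp
  also have "\<dots> = z + x2 + (x + z) + (x + x1)" by (simp only: add.assoc)
  also have "\<dots> = z + (x2 + z) + (x + x) + x1" by (simp only: a(1) add.assoc)
  also have "\<dots> = z + (z + (x2 + z) + x1)" by (simp only: a(6) z_def[symmetric] add.assoc)
  also have "\<dots> = z + (z + z + x2 + x1)" by (simp only: a(6) add.assoc)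
  finally have "y = z + z + x2 + x1" by simp
  then have "z = (z + z + x2 + x1) + (z + x1 + x2)" using yyy y3 by metis
  also have "\<dots> = z + z + x2 + (x1 + z) + (x1 + x2)" by (simp only: add.assoc)
  also have "\<dots> = z + z + (x2 + z) + (x1 + x1) + x2" by (simp only: x1z add.assoc)
  also have "\<dots> = z + z + z + (x2 + z) + x2" by (simp only: a(6) x11 add.assoc)
  also have "\<dots> = z + z + z + z + (x2 + x2)" by (simp only: a(6) add.assoc)
  finally have "zmul 4 z = 0"
    using zmul_plus_one[of 3 z] add_left_imp_eq[of z "z + (z + (z + z))" 0]
    by (simp add: a(4) zmul_numeral_unfold add.assoc)
  then have "zmul 4 (zmul 2 x) = 0" by (simp add: zmul_numeral_unfold z_def)
  then show False using zmul_eqD[of 8 0] by (simp flip: zmul_mult)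
qed

end

section \<open>The same clashes as statements on colour words\<close>

context three_by
begin

context
  fixes p q r assumes A: "{p, q, r} = A"
begin

lemma clash_01012021_01202102:
  assumes R1: "alt [p, q, p, q, r, p, r, q] = 0" and R2: "alt [p, q, r, p, r, q, p, r] = 0"
  shows False
proof -
  obtain x y where xy: "q = p + x" "r = p + y" and ne: "x \<noteq> 0" "y \<noteq> 0" "x \<noteq> y"
    using base_point[OF A] by blast
  interpret trefoil x y by unfold_locales (use tf ne in auto)
  have W1: "- x + (y + (y + (- x + - x))) = 0" using R1 by (simp only: xy word_simps)
  have W2: "- y + (- x + (y + (y + - x))) = 0" using R2 by (simp only: xy word_simps)
  have e1: "y + y = x + (x + x)"
    using arg_cong[OF W1, of "\<lambda>w. x + (w + (x + x))"] by (simp only: word_simps)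
  have e2: "y + y = x + (y + x)"
    using arg_cong[OF W2, of "\<lambda>w. x + (y + (w + x))"] by (simp only: word_simps)
  show False using e1 e2 ne by simp
qed

lemma clash_01012021_01021012:
  assumes R1: "alt [p, q, p, q, r, p, r, q] = 0" and R2: "alt [p, q, p, r, q, p, q, r] = 0"
  shows False
proof -
  obtain x y where xy: "q = p + x" "r = p + y" and ne: "x \<noteq> 0" "y \<noteq> 0" "x \<noteq> y"
    using base_point[OF A] by blast
  interpret trefoil x y by unfold_locales (use tf ne in auto)
  have W1: "- x + (y + (y + (- x + - x))) = 0" using R1 by (simp only: xy word_simps)
  have W2: "- y + (x + (x + (- y + - x))) = 0" using R2 by (simp only: xy word_simps)
  have e1: "y + y = x + (x + x)"
    using arg_cong[OF W1, of "\<lambda>w. x + (w + (x + x))"] by (simp only: word_simps)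
  have e2: "x + x = y + (x + y)"
    using arg_cong[OF W2, of "\<lambda>w. y + (w + (x + y))"] by (simp only: word_simps)
  show False using clash_cube_sandwich[OF e1 e2] .
qed

lemma clash_01012021_01202021:
  assumes R1: "alt [p, q, p, q, r, p, r, q] = 0" and R2: "alt [p, q, r, p, r, p, r, q] = 0"
  shows False
proof -
  obtain x y where xy: "q = p + x" "r = p + y" and ne: "x \<noteq> 0" "y \<noteq> 0" "x \<noteq> y"
    using base_point[OF A] by blast
  interpret trefoil x y by unfold_locales (use tf ne in auto)
  have W1: "- x + (y + (y + (- x + - x))) = 0" using R1 by (simp only: xy word_simps)
  have W2: "- x + (y + (y + (y + - x))) = 0" using R2 by (simp only: xy word_simps)
  have e1: "y + y = x + (x + x)"
    using arg_cong[OF W1, of "\<lambda>w. x + (w + (x + x))"] by (simp only: word_simps)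
  have e2: "y + (y + y) = x + x"
    using arg_cong[OF W2, of "\<lambda>w. x + (w + x)"] by (simp only: word_simps)
  show False using clash_cubes[OF e1 e2] .
qed

lemma clash_01021012_01202102:
  assumes R1: "alt [p, q, p, r, q, p, q, r] = 0" and R2: "alt [p, q, r, p, r, q, p, r] = 0"
  shows False
proof -
  obtain x y where xy: "q = p + x" "r = p + y" and ne: "x \<noteq> 0" "y \<noteq> 0" "x \<noteq> y"
    using base_point[OF A] by blast
  interpret trefoil x y by unfold_locales (use tf ne in auto)
  have W1: "- y + (x + (x + (- y + - x))) = 0" using R1 by (simp only: xy word_simps)
  have W2: "- y + (- x + (y + (y + - x))) = 0" using R2 by (simp only: xy word_simps)
  have e1: "x + x = y + (x + y)"
    using arg_cong[OF W1, of "\<lambda>w. y + (w + (x + y))"] by (simp only: word_simps)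
  have e2: "y + y = x + (y + x)"
    using arg_cong[OF W2, of "\<lambda>w. x + (y + (w + x))"] by (simp only: word_simps)
  show False using clash_sandwiches[OF e1 e2] .
qed

lemma clash_01012021_01212102:
  assumes R1: "alt [p, q, p, q, r, p, r, q] = 0" and R2: "alt [p, q, r, q, r, q, p, r] = 0"
  shows False
proof -
  obtain x y where xy: "q = p + x" "r = p + y" and ne: "x \<noteq> 0" "y \<noteq> 0" "x \<noteq> y"
    using base_point[OF A] by blast
  interpret trefoil x y by unfold_locales (use tf ne in auto)
  have W1: "- x + (y + (y + (- x + - x))) = 0" using R1 by (simp only: xy word_simps)
  have W2: "- y + (- x + (y + (- x + (y + - x)))) = 0" using R2 by (simp only: xy word_simps)
  have e1: "y + y = x + (x + x)"
    using arg_cong[OF W1, of "\<lambda>w. x + (w + (x + x))"] by (simp only: word_simps)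
  have e2: "y + (- x + y) = x + (y + x)"
    using arg_cong[OF W2, of "\<lambda>w. x + (y + (w + x))"] by (simp only: word_simps)
  show False using clash_quaternion[OF e1 e2] .
qed

lemma clash_01021012_01210202:
  assumes R1: "alt [p, q, p, r, q, p, q, r] = 0" and R2: "alt [p, q, r, q, p, r, p, r] = 0"
  shows False
proof -
  obtain x y where xy: "q = p + x" "r = p + y" and ne: "x \<noteq> 0" "y \<noteq> 0" "x \<noteq> y"
    using base_point[OF A] by blast
  interpret trefoil x y by unfold_locales (use tf ne in auto)
  have W1: "- y + (x + (x + (- y + - x))) = 0" using R1 by (simp only: xy word_simps)
  have W2: "- y + (- y + (- x + (y + - x))) = 0" using R2 by (simp only: xy word_simps)
  have e1: "x + x = y + (x + y)"
    using arg_cong[OF W1, of "\<lambda>w. y + (w + (x + y))"] by (simp only: word_simps)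
  have e2: "y = x + (y + (y + x))"
    using arg_cong[OF W2, of "\<lambda>w. x + (y + (y + (w + x)))"] by (simp only: word_simps)
  show False using clash_sandwich_palindrome[OF e1 e2] .
qed

lemma clash_01202021_01210202:
  assumes R1: "alt [p, q, r, p, r, p, r, q] = 0" and R2: "alt [p, q, r, q, p, r, p, r] = 0"
  shows False
proof -
  obtain x y where xy: "q = p + x" "r = p + y" and ne: "x \<noteq> 0" "y \<noteq> 0" "x \<noteq> y"
    using base_point[OF A] by blast
  interpret trefoil x y by unfold_locales (use tf ne in auto)
  have W1: "- x + (y + (y + (y + - x))) = 0" using R1 by (simp only: xy word_simps)
  have W2: "- y + (- y + (- x + (y + - x))) = 0" using R2 by (simp only: xy word_simps)
  have e1: "y + (y + y) = x + x"
    using arg_cong[OF W1, of "\<lambda>w. x + (w + x)"] by (simp only: word_simps)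
  have e2: "y = x + (y + (y + x))"
    using arg_cong[OF W2, of "\<lambda>w. x + (y + (y + (w + x)))"] by (simp only: word_simps)
  show False using clash_square_palindrome[OF e1 e2] .
qed

lemma clash_01202021_01212102:
  assumes R1: "alt [p, q, r, p, r, p, r, q] = 0" and R2: "alt [p, q, r, q, r, q, p, r] = 0"
  shows False
proof -
  obtain x y where xy: "q = p + x" "r = p + y" and ne: "x \<noteq> 0" "y \<noteq> 0" "x \<noteq> y"
    using base_point[OF A] by blast
  interpret trefoil x y by unfold_locales (use tf ne in auto)
  have W1: "- x + (y + (y + (y + - x))) = 0" using R1 by (simp only: xy word_simps)
  have W2: "- y + (- x + (y + (- x + (y + - x)))) = 0" using R2 by (simp only: xy word_simps)
  have e1: "y + (y + y) = x + x"
    using arg_cong[OF W1, of "\<lambda>w. x + (w + x)"] by (simp only: word_simps)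
  have e2: "y + (- x + y) = x + (y + x)"
    using arg_cong[OF W2, of "\<lambda>w. x + (y + (w + x))"] by (simp only: word_simps)
  show False using clash_square_twist[OF e1 e2] .
qed

end
end

section \<open>Colour words up to rereading and renaming\<close>

datatype col = C0 | C1 | C2

lemma UNIV_col: "UNIV = {C0, C1, C2}"
  using col.exhaust by auto

text \<open>
  Rotations by an even number of places and reversals of a word: the ways of reading the same closed
  walk. Four rotations exhaust all words of length at most 8.
\<close>

fun spins :: "nat \<Rightarrow> 'b list \<Rightarrow> 'b list list" where
  "spins (Suc n) (a # b # cs) = (a # b # cs) # rev (a # b # cs) # spins n (cs @ [a, b])"
| "spins n cs = []"

abbreviation cyc :: "'b list \<Rightarrow> 'b list list" where
  "cyc \<equiv> spins (Suc (Suc (Suc (Suc 0))))"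

definition relabel :: "col list \<Rightarrow> col \<Rightarrow> col" where
  "relabel d x = (if x = hd d then C0 else if x = hd (tl d) then C1 else C2)"

text \<open>The filter makes every \<open>relabel d\<close> a bijection without any assumption on
  \<open>c\<close>; on closed walks it removes nothing.\<close>

definition forms :: "col list \<Rightarrow> col list list" where
  "forms c = map (\<lambda>d. map (relabel d) d) (filter (\<lambda>d. hd d \<noteq> hd (tl d)) (cyc c))"

lemma alt_append: "even (length xs) \<Longrightarrow> alt (xs @ ys) = alt ys + alt xs"
  by (induction xs rule: alt.induct) (simp_all add: add.assoc)

lemma alt_rev: "even (length xs) \<Longrightarrow> alt (rev xs) = - alt xs"
proof (induction xs rule: alt.induct)
  case (1 a b cs)
  then show ?case using alt_append[of "rev cs" "[b, a]"] by (simp add: minus_add)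
qed auto

text \<open>Rotation by two places conjugates \<open>alt\<close>, and reversal negates it.\<close>

lemma alt_spins:
  assumes "c' \<in> set (spins n c)" "even (length c)"
  shows "alt c' = 0 \<longleftrightarrow> alt c = 0"
  using assms
proof (induction n c rule: spins.induct)
  case (1 n a b cs)
  consider "c' = a # b # cs" | "c' = rev (a # b # cs)" | "c' \<in> set (spins n (cs @ [a, b]))"
    using 1(2) by auto
  then show ?case
  proof cases
    case 2
    then show ?thesis using alt_rev[of "a # b # cs"] 1(3) by simp
  next
    case 3
    have "alt (cs @ [a, b]) = (- b + a) + alt cs" using alt_append[of cs "[a, b]"] 1(3) by simp
    moreover have "(- b + a) + alt cs = 0 \<longleftrightarrow> alt cs + (- b + a) = 0"
      by (metis eq_neg_iff_add_eq_0 neg_eq_iff_add_eq_0)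
    ultimately show ?thesis using 1(1)[OF 3] 1(3) by simp
  qed simp
qed simp_all

lemma spins_map: "spins n (map h c) = map (map h) (spins n c)"
  by (induction n c rule: spins.induct) (simp_all add: rev_map)

lemma bij_relabel: "hd d \<noteq> hd (tl d) \<Longrightarrow> bij (relabel d)"
proof -
  assume "hd d \<noteq> hd (tl d)"
  then have *: "relabel d C0 \<noteq> relabel d C1" "relabel d C0 \<noteq> relabel d C2" "relabel d C1 \<noteq> relabel d C2"
    by (cases "hd d"; cases "hd (tl d)"; simp add: relabel_def)+
  have "inj (relabel d)"
  proof (rule injI)
    fix x y assume "relabel d x = relabel d y"
    with * show "x = y" by (cases x; cases y) auto
  qed
  moreover have "finite (UNIV :: col set)" by (simp add: UNIV_col)
  ultimately show ?thesis by (simp add: bij_def finite_UNIV_inj_surj)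
qed

lemma map_inv_relabel:
  assumes "hd d \<noteq> hd (tl d)"
  shows "map (h \<circ> inv (relabel d)) (map (relabel d) e) = map h e"
  using bij_relabel[OF assms] by (simp add: comp_assoc bij_is_inj)

context three_by
begin

definition coloring :: "(col \<Rightarrow> 'a) \<Rightarrow> bool" where
  "coloring h \<longleftrightarrow> range h = A"

lemma coloring_set: "coloring h \<longleftrightarrow> {h C0, h C1, h C2} = A"
  by (simp add: coloring_def UNIV_col)

lemma coloring_relabel:
  assumes "coloring h" "hd d \<noteq> hd (tl d)"
  shows "coloring (h \<circ> inv (relabel d))"
proof -
  have "range (inv (relabel d)) = UNIV" using bij_relabel[OF assms(2)] bij_imp_bij_inv bij_is_surj by blast
  with assms(1) show ?thesis unfolding coloring_def by (metis image_comp)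
qed

text \<open>A renaming of letters is absorbed by the colouring. Since the \<open>no_\<close> lemmas
  hold for every colouring, representatives are enough.\<close>

lemma forms_alt:
  assumes "b \<in> set (forms c)" "even (length c)" "coloring h" "alt (map h c) = 0"
  obtains g where "coloring g" "alt (map g b) = 0"
proof -
  obtain d where d: "hd d \<noteq> hd (tl d)" "d \<in> set (cyc c)" "b = map (relabel d) d"
    using assms(1) by (auto simp: forms_def simp del: spins.simps)
  then have "map h d \<in> set (cyc (map h c))" unfolding spins_map set_map by (intro imageI)
  then have "alt (map h d) = 0" using alt_spins[of "map h d" _ "map h c"] assms(2,4) by simp
  then have "alt (map (h \<circ> inv (relabel d)) b) = 0"
    unfolding d(3) map_inv_relabel[OF d(1)] .
  with that coloring_relabel[OF assms(3) d(1)] show ?thesis by blast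
qed

end

text \<open>Words of length \<open>n + 1\<close> without equal neighbours.\<close>

fun walks :: "nat \<Rightarrow> col list list" where
  "walks 0 = [[C0], [C1], [C2]]"
| "walks (Suc n) = concat (map (\<lambda>w. map (\<lambda>c. c # w) (filter (\<lambda>c. c \<noteq> hd w) [C0, C1, C2])) (walks n))"

definition bad4 :: "col list list" where "bad4 = [
    [C0, C1, C0, C1],
    [C0, C1, C0, C2]]"

definition bad6 :: "col list list" where "bad6 = [
    [C0, C1, C0, C1, C0, C1],
    [C0, C1, C0, C1, C0, C2],
    [C0, C1, C0, C2, C1, C2],
    [C0, C1, C2, C0, C1, C2]]"

definition bad8 :: "col list list" where "bad8 = [
    [C0, C1, C0, C1, C0, C1, C0, C1],
    [C0, C1, C0, C1, C0, C1, C0, C2],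
    [C0, C1, C0, C1, C0, C2, C0, C2],
    [C0, C1, C0, C1, C2, C0, C1, C2],
    [C0, C1, C0, C1, C2, C1, C0, C2],
    [C0, C1, C0, C2, C0, C1, C0, C2],
    [C0, C1, C0, C2, C0, C1, C2, C1],
    [C0, C1, C0, C2, C1, C0, C2, C1]]"

text \<open>
  The two trefoil relations: over a suitable base point they read \<open>2 x = 3 y\<close> and \<open>2 x = y + x + y\<close>.
  Up to equivalence they are numbers 4 and 9 in the list of words of length 8.
\<close>

abbreviation K4 :: "col list" where "K4 \<equiv> [C0, C1, C0, C1, C0, C2, C1, C2]"
abbreviation K9 :: "col list" where "K9 \<equiv> [C0, C1, C0, C2, C1, C0, C1, C2]"

definition clashes :: "(col list \<times> col list) list" where
  "clashes = [
    ([C0, C1, C0, C1, C2, C0, C2, C1],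
     [C0, C1, C2, C0, C2, C1, C0, C2]),
    ([C0, C1, C0, C1, C2, C0, C2, C1],
     [C0, C1, C0, C2, C1, C0, C1, C2]),
    ([C0, C1, C0, C1, C2, C0, C2, C1],
     [C0, C1, C2, C0, C2, C0, C2, C1]),
    ([C0, C1, C0, C2, C1, C0, C1, C2],
     [C0, C1, C2, C0, C2, C1, C0, C2]),
    ([C0, C1, C0, C1, C2, C0, C2, C1],
     [C0, C1, C2, C1, C2, C1, C0, C2]),
    ([C0, C1, C0, C2, C1, C0, C1, C2],
     [C0, C1, C2, C1, C0, C2, C0, C2]),
    ([C0, C1, C2, C0, C2, C0, C2, C1],
     [C0, C1, C2, C1, C0, C2, C0, C2]),
    ([C0, C1, C2, C0, C2, C0, C2, C1],
     [C0, C1, C2, C1, C2, C1, C0, C2])]"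

text \<open>Both words vanish under one colouring, so they may only be renamed together: the reading
  \<open>d\<close> of \<open>K\<close> fixes the renaming, and the reading \<open>e\<close> of
  \<open>c\<close> has to follow it.\<close>

definition clashing :: "col list \<Rightarrow> col list \<Rightarrow> bool" where
  "clashing K c \<longleftrightarrow> list_ex (\<lambda>d. hd d \<noteq> hd (tl d) \<and> list_ex (\<lambda>e.
     List.member clashes (map (relabel d) d, map (relabel d) e) \<or>
     List.member clashes (map (relabel d) e, map (relabel d) d)) (cyc c)) (cyc K)"

definition meets :: "col list list \<Rightarrow> col list \<Rightarrow> bool" where
  "meets bs c \<longleftrightarrow> list_ex (List.member bs) (forms c)"

definition closed_walks :: "nat \<Rightarrow> col list list" where
  "closed_walks n = filter (\<lambda>c. last c \<noteq> hd c) (walks n)"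

lemma classify4: "list_all (meets bad4) (closed_walks 3)"
  unfolding numeral_eq_Suc pred_numeral_simps BitM.simps by code_simp

lemma classify6: "list_all (meets bad6) (closed_walks 5)"
  unfolding numeral_eq_Suc pred_numeral_simps BitM.simps by code_simp

lemma classify8: "list_all (meets (K4 # K9 # bad8)) (closed_walks 7)"
  unfolding numeral_eq_Suc pred_numeral_simps BitM.simps by code_simp

text \<open>The colouring is fixed here, so this says more than a comparison of classes: even a
  recoloured copy of \<open>K4\<close> clashes with \<open>K4\<close> unless it describes the same
  closed walk, and likewise for \<open>K9\<close>.\<close>

lemma unique_relation:
  "list_all (\<lambda>c. if meets bad8 c then True else if List.member (cyc K4) c then True else clashing K4 c) (closed_walks 7)"
  "list_all (\<lambda>c. if meets bad8 c then True else if List.member (cyc K9) c then True else clashing K9 c) (closed_walks 7)"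
  unfolding numeral_eq_Suc pred_numeral_simps BitM.simps by code_simp+

lemma walks_Cons: "w \<in> set (walks n) \<Longrightarrow> c \<noteq> hd w \<Longrightarrow> c # w \<in> set (walks (Suc n))"
  by (cases c) auto

lemma closed_walks_mem:
  "a \<noteq> b \<Longrightarrow> b \<noteq> c \<Longrightarrow> c \<noteq> d \<Longrightarrow> d \<noteq> a \<Longrightarrow> [a, b, c, d] \<in> set (closed_walks 3)"
  "a \<noteq> b \<Longrightarrow> b \<noteq> c \<Longrightarrow> c \<noteq> d \<Longrightarrow> d \<noteq> e \<Longrightarrow> e \<noteq> f \<Longrightarrow> f \<noteq> a \<Longrightarrow> [a, b, c, d, e, f] \<in> set (closed_walks 5)"
  "a \<noteq> b \<Longrightarrow> b \<noteq> c \<Longrightarrow> c \<noteq> d \<Longrightarrow> d \<noteq> e \<Longrightarrow> e \<noteq> f \<Longrightarrow> f \<noteq> g \<Longrightarrow> g \<noteq> h \<Longrightarrow> h \<noteq> a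
    \<Longrightarrow> [a, b, c, d, e, f, g, h] \<in> set (closed_walks 7)"
proof -
  have w0: "[a] \<in> set (walks 0)" for a by (cases a) auto
  have n: "3 = Suc (Suc (Suc 0))" "5 = Suc (Suc (Suc (Suc (Suc 0))))"
    "7 = Suc (Suc (Suc (Suc (Suc (Suc (Suc 0))))))" by simp_all
  show "a \<noteq> b \<Longrightarrow> b \<noteq> c \<Longrightarrow> c \<noteq> d \<Longrightarrow> d \<noteq> a \<Longrightarrow> [a, b, c, d] \<in> set (closed_walks 3)"
    unfolding closed_walks_def n set_filter by (intro CollectI conjI walks_Cons w0) simp_all
  show "a \<noteq> b \<Longrightarrow> b \<noteq> c \<Longrightarrow> c \<noteq> d \<Longrightarrow> d \<noteq> e \<Longrightarrow> e \<noteq> f \<Longrightarrow> f \<noteq> a \<Longrightarrow> [a, b, c, d, e, f] \<in> set (closed_walks 5)"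
    unfolding closed_walks_def n set_filter by (intro CollectI conjI walks_Cons w0) simp_all
  show "a \<noteq> b \<Longrightarrow> b \<noteq> c \<Longrightarrow> c \<noteq> d \<Longrightarrow> d \<noteq> e \<Longrightarrow> e \<noteq> f \<Longrightarrow> f \<noteq> g \<Longrightarrow> g \<noteq> h \<Longrightarrow> h \<noteq> a
    \<Longrightarrow> [a, b, c, d, e, f, g, h] \<in> set (closed_walks 7)"
    unfolding closed_walks_def n set_filter by (intro CollectI conjI walks_Cons w0) simp_all
qed

lemma length_walks: "c \<in> set (walks n) \<Longrightarrow> length c = Suc n"
  by (induction n arbitrary: c) auto

context three_by
begin

lemma no_bad:
  assumes "coloring h"
  shows "b \<in> set bad4 \<Longrightarrow> alt (map h b) \<noteq> 0" "b \<in> set bad6 \<Longrightarrow> alt (map h b) \<noteq> 0"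
    "b \<in> set bad8 \<Longrightarrow> alt (map h b) \<noteq> 0"
proof -
  have A: "{h C0, h C1, h C2} = A" using assms by (simp add: coloring_set)
  show "b \<in> set bad4 \<Longrightarrow> alt (map h b) \<noteq> 0"
    using no_0101[OF A] no_0102[OF A] by (auto simp: bad4_def simp del: alt.simps)
  show "b \<in> set bad6 \<Longrightarrow> alt (map h b) \<noteq> 0"
    using no_010101[OF A] no_010102[OF A] no_010212[OF A] no_012012[OF A]
    by (auto simp: bad6_def simp del: alt.simps)
  show "b \<in> set bad8 \<Longrightarrow> alt (map h b) \<noteq> 0"
    using no_01010101[OF A] no_01010102[OF A] no_01010202[OF A] no_01012012[OF A] no_01012102[OF A]
      no_01020102[OF A] no_01020121[OF A] no_01021021[OF A]
    by (auto simp: bad8_def simp del: alt.simps)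
qed

lemma meets_alt:
  assumes "meets bs c" "even (length c)" "coloring h" "alt (map h c) = 0"
  obtains b g where "b \<in> set bs" "coloring g" "alt (map g b) = 0"
proof -
  obtain b where "b \<in> set bs" "b \<in> set (forms c)"
    using assms(1) by (auto simp: meets_def list_ex_iff)
  with forms_alt[of b c h] assms that show ?thesis by metis
qed

lemma clash:
  assumes "(c, d) \<in> set clashes" "coloring h" "alt (map h c) = 0" "alt (map h d) = 0"
  shows False
proof -
  have A: "{h C0, h C1, h C2} = A" using assms by (simp add: coloring_set)
  show ?thesis
    using assms(1,3,4) clash_01012021_01202102[OF A] clash_01012021_01021012[OF A] clash_01012021_01202021[OF A] clash_01021012_01202102[OF A] clash_01012021_01212102[OF A] clash_01021012_01210202[OF A] clash_01202021_01210202[OF A] clash_01202021_01212102[OF A]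
    by (auto simp: clashes_def simp del: alt.simps)
qed

lemma clashing_absurd:
  assumes "clashing K c" "coloring h" "alt (map h K) = 0" "alt (map h c) = 0" "even (length K)" "even (length c)"
  shows False
proof -
  obtain d e where de: "hd d \<noteq> hd (tl d)" "d \<in> set (cyc K)" "e \<in> set (cyc c)"
    and *: "(map (relabel d) d, map (relabel d) e) \<in> set clashes \<or> (map (relabel d) e, map (relabel d) d) \<in> set clashes"
    using assms(1) unfolding clashing_def by (auto simp: list_ex_iff simp del: spins.simps)
  have "map h d \<in> set (cyc (map h K))" "map h e \<in> set (cyc (map h c))"
    unfolding spins_map using de by simp_all
  then have "alt (map h d) = 0" "alt (map h e) = 0"
    using alt_spins[of "map h d" _ "map h K"] alt_spins[of "map h e" _ "map h c"] assms by simp_all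
  then have "alt (map (h \<circ> inv (relabel d)) (map (relabel d) d)) = 0"
    "alt (map (h \<circ> inv (relabel d)) (map (relabel d) e)) = 0"
    unfolding map_inv_relabel[OF de(1)] .
  with * clash coloring_relabel[OF assms(2) de(1)] show False by blast
qed

lemma no_short_cycles:
  assumes h: "coloring h"
  shows "c \<in> set (closed_walks 3) \<Longrightarrow> alt (map h c) \<noteq> 0" "c \<in> set (closed_walks 5) \<Longrightarrow> alt (map h c) \<noteq> 0"
proof -
  have *: "alt (map h c) \<noteq> 0" if bs: "meets bs c" "even (length c)" "bs \<in> {bad4, bad6}" for bs
  proof
    assume "alt (map h c) = 0"
    then obtain b g where "b \<in> set bs" "coloring g" "alt (map g b) = 0"
      using meets_alt[OF bs(1,2) h] by blast
    with no_bad bs(3) show False by blast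
  qed
  show "alt (map h c) \<noteq> 0" if c: "c \<in> set (closed_walks 3)"
  proof (rule *)
    show "meets bad4 c" using classify4 c by (simp add: list_all_iff)
    show "even (length c)" using length_walks[of c 3] c by (simp add: closed_walks_def)
  qed simp
  show "alt (map h c) \<noteq> 0" if c: "c \<in> set (closed_walks 5)"
  proof (rule *)
    show "meets bad6 c" using classify6 c by (simp add: list_all_iff)
    show "even (length c)" using length_walks[of c 5] c by (simp add: closed_walks_def)
  qed simp
qed

lemma normal_coloring:
  obtains h K where "coloring h" "K \<in> {K4, K9}"
    "\<And>c. c \<in> set (closed_walks 7) \<Longrightarrow> alt (map h c) = 0 \<Longrightarrow> c \<in> set (cyc K)"
proof (cases "\<exists>h K. coloring h \<and> K \<in> {K4, K9} \<and> alt (map h K) = 0")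
  case True
  then obtain h K where hK: "coloring h" "K \<in> {K4, K9}" "alt (map h K) = 0" by blast
  show ?thesis
  proof (rule that[OF hK(1,2)])
    fix c assume c: "c \<in> set (closed_walks 7)" "alt (map h c) = 0"
    have len: "even (length c)" "even (length K)" using c length_walks[of c 7] hK(2) by (auto simp: closed_walks_def)
    have "c \<in> set (cyc K) \<or> meets bad8 c \<or> clashing K c"
      using c(1) unique_relation hK(2) by (auto simp: list_all_iff simp del: spins.simps split: if_splits)
    moreover have "\<not> clashing K c" using clashing_absurd[OF _ hK(1,3) c(2) len(2,1)] by blast
    moreover have "\<not> meets bad8 c"
    proof
      assume "meets bad8 c"
      then obtain b g where "b \<in> set bad8" "coloring g" "alt (map g b) = 0"
        using meets_alt[OF _ len(1) hK(1) c(2)] by blast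
      with no_bad(3) show False by blast
    qed
    ultimately show "c \<in> set (cyc K)" by blast
  qed
next
  case False
  \<comment> \<open>Neither trefoil relation holds under any colouring, so by
    \<open>classify8\<close> no square word vanishes. Colouring and relation are then arbitrary, and
    \<open>K4\<close> serves as a dummy.\<close>
  obtain p q r where pqr: "A = {p, q, r}" using card_A by (metis card_3_iff)
  then have h: "coloring (\<lambda>c. case c of C0 \<Rightarrow> p | C1 \<Rightarrow> q | C2 \<Rightarrow> r)" (is "coloring ?h")
    unfolding coloring_set col.case by (simp only: pqr)
  show ?thesis
  proof (rule that[OF h])
    fix c assume c: "c \<in> set (closed_walks 7)" "alt (map ?h c) = 0"
    have len: "even (length c)" using c length_walks[of c 7] by (auto simp: closed_walks_def)
    have "meets (K4 # K9 # bad8) c" using classify8 c(1) by (simp add: list_all_iff)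
    then obtain b g where "b \<in> set (K4 # K9 # bad8)" "coloring g" "alt (map g b) = 0"
      using meets_alt[OF _ len h c(2)] by metis
    moreover from this(2,3) no_bad(3) have "b \<notin> set bad8" by blast
    ultimately have False using False by auto
    then show "c \<in> set (cyc K4)" ..
  qed simp
qed

end

section \<open>Counting in the product graph\<close>

text \<open>
  A vertex \<open>b\<close> has a port for each colour, and \<open>pr b i\<close> is the product \<open>h i + b\<close> behind port \<open>i\<close>. Two
  vertices are adjacent if they share a product; an exposed port carries a unique product.
\<close>

locale port_graph =
  fixes B :: "'b set" and pr :: "'b \<Rightarrow> col \<Rightarrow> 'p" and K :: "col list"
  assumes finite_B: "finite B" and nonempty_B: "B \<noteq> {}"
    and pr_inj: "pr b i = pr c i \<Longrightarrow> b = c"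
    and pr_ne: "pr b i = pr b j \<Longrightarrow> i = j"
    and exposed_unique: "\<lbrakk>b \<in> B; c \<in> B;
      \<And>b' i'. b' \<in> B \<Longrightarrow> pr b' i' = pr b i \<Longrightarrow> i' = i;
      \<And>b' i'. b' \<in> B \<Longrightarrow> pr b' i' = pr c j \<Longrightarrow> i' = j\<rbrakk> \<Longrightarrow> b = c \<and> i = j"
    and digon_free: "\<lbrakk>pr a i = pr b i'; pr b j = pr a j'; distinct_adj [i, i', j, j', i]\<rbrakk> \<Longrightarrow> False"
    and triangle_free: "\<lbrakk>pr a i = pr b i'; pr b j = pr c j'; pr c k = pr a k';
      distinct_adj [i, i', j, j', k, k', i]\<rbrakk> \<Longrightarrow> False"
    and square_word: "\<lbrakk>pr a i = pr b i'; pr b j = pr c j'; pr c k = pr d k'; pr d l = pr a l';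
      distinct_adj [i, i', j, j', k, k', l, l', i]\<rbrakk> \<Longrightarrow> [i, i', j, j', k, k', l, l'] \<in> set (cyc K)"
begin

text \<open>Two different ports would give a digon with a proper colour word.\<close>

lemma two_cycle:
  assumes "pr a i = pr b i'" "i \<noteq> i'" "pr a k = pr b k'" "k \<noteq> k'"
  shows "i = k"
proof (rule ccontr)
  assume "i \<noteq> k"
  moreover have "i' \<noteq> k'" using assms pr_ne[of a i k] \<open>i \<noteq> k\<close> by auto
  ultimately show False using digon_free[of a i b i' k' k] assms by (auto dest: sym)
qed

lemma triangle1:
  assumes e: "pr a i = pr b i'" "pr b j = pr c j'" "pr c k = pr a k'"
    and n: "i \<noteq> i'" "j \<noteq> j'" "k \<noteq> k'" and "i' = j"
  shows "j' = k \<and> k' = i"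
proof -
  have *: "pr a i = pr c j'" using assms by simp
  have "i \<noteq> j'" using pr_inj * e(3) n(3) pr_ne by metis
  then have "i = k'" using two_cycle[of a i c j' k' k] * e(3) n(3) by simp
  then have "j' = k" using * e(3) pr_ne by metis
  with \<open>i = k'\<close> show ?thesis by simp
qed

text \<open>By \<open>triangle1\<close>, backtracking at one corner means that all three vertices
  share one product, so backtracking occurs at every corner or at none; the latter is a proper
  triangle.\<close>

lemma triangle:
  assumes "pr a i = pr b i'" "pr b j = pr c j'" "pr c k = pr a k'" "i \<noteq> i'" "j \<noteq> j'" "k \<noteq> k'"
  shows "i' = j"
proof (rule ccontr)
  assume *: "i' \<noteq> j"
  have "j' \<noteq> k" using triangle1[of b j c j' k a k' i i'] assms * by auto
  moreover have "k' \<noteq> i" using triangle1[of c k a k' i b i' j j'] assms * by auto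
  ultimately show False using triangle_free[of a i b i' j c j' k k'] assms * by auto
qed

text \<open>Proper turns at \<open>b\<close> and \<open>c\<close> suffice: backtracking at
  \<open>d\<close> or \<open>a\<close> would replace two sides by a diagonal and leave a triangle
  with a proper turn.\<close>

lemma square:
  assumes e: "pr a i = pr b i'" "pr b j = pr c j'" "pr c k = pr d k'" "pr d l = pr a l'"
    and n: "i \<noteq> i'" "j \<noteq> j'" "k \<noteq> k'" "l \<noteq> l'" and "i' \<noteq> j" "j' \<noteq> k" "b \<noteq> d" "a \<noteq> c"
  shows "[i, i', j, j', k, k', l, l'] \<in> set (cyc K)"
proof -
  have "k' \<noteq> l"
  proof
    assume "k' = l"
    then have *: "pr c k = pr a l'" using e by simp
    show False
    proof (cases "k = l'")
      case True
      with * pr_inj \<open>a \<noteq> c\<close> show False by blast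
    next
      case False
      with triangle[of a i b i' j c j' k l'] e * n \<open>i' \<noteq> j\<close> show False by blast
    qed
  qed
  moreover have "l' \<noteq> i"
  proof
    assume "l' = i"
    then have *: "pr d l = pr b i'" using e by simp
    show False
    proof (cases "l = i'")
      case True
      with * pr_inj \<open>b \<noteq> d\<close> show False by blast
    next
      case False
      with triangle[of b j c j' k d k' l i'] e * n \<open>j' \<noteq> k\<close> show False by blast
    qed
  qed
  ultimately show ?thesis using square_word[OF e] assms by auto
qed

section \<open>Exposed ports and the choice of a root\<close>

definition exposed :: "'b \<Rightarrow> col \<Rightarrow> bool" where
  "exposed b i \<longleftrightarrow> (\<forall>b'\<in>B. \<forall>i'. pr b' i' = pr b i \<longrightarrow> i' = i)"

lemma exposed_eq: "exposed b i \<Longrightarrow> exposed c j \<Longrightarrow> b \<in> B \<Longrightarrow> c \<in> B \<Longrightarrow> b = c \<and> i = j"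
  unfolding exposed_def using exposed_unique[of b c i j] by blast

lemma partner:
  assumes "\<not> exposed b i"
  obtains b' i' where "b' \<in> B" "i' \<noteq> i" "pr b i = pr b' i'"
  using assms unfolding exposed_def by metis

lemma other_colors: obtains j k where "j \<noteq> k" "j \<noteq> i" "k \<noteq> (i :: col)"
  by (cases i) (use col.distinct in metis)+

text \<open>A neighbour \<open>b\<close> of \<open>e\<close> has all its ports covered; with its
  partners through the two other ports it makes three vertices, one more than the pigeonhole in
  \<open>good_root\<close> tolerates.\<close>

lemma card_Diff_exposed:
  assumes e0: "e \<in> B" "exposed e a"
  shows "card (B - {e}) \<ge> 3"
proof -
  have cov: "\<not> exposed b i" if "b \<in> B" "(b, i) \<noteq> (e, a)" for b i
    using exposed_eq[OF _ e0(2) that(1) e0(1)] that(2) by blast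
  obtain j where j: "j \<noteq> a" using other_colors by blast
  obtain b k where b: "b \<in> B" "k \<noteq> j" "pr e j = pr b k"
    using partner[OF cov[OF e0(1)]] j by auto
  have "b \<noteq> e" using b pr_ne by blast
  obtain l m where lm: "l \<noteq> m" "l \<noteq> k" "m \<noteq> k" using other_colors .
  obtain c i where c: "c \<in> B" "i \<noteq> l" "pr b l = pr c i"
    using partner[OF cov[OF b(1)]] \<open>b \<noteq> e\<close> by auto
  obtain d n where d: "d \<in> B" "n \<noteq> m" "pr b m = pr d n"
    using partner[OF cov[OF b(1)]] \<open>b \<noteq> e\<close> by auto
  have "c \<noteq> e" "d \<noteq> e"
    using two_cycle[of b k e j l i] two_cycle[of b k e j m n] b c d lm by auto
  moreover have "c \<noteq> d" using two_cycle[of b l c i m n] c d lm by auto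
  moreover have "c \<noteq> b" "d \<noteq> b" using c d pr_ne by blast+
  ultimately have "card {b, c, d} = 3" "{b, c, d} \<subseteq> B - {e}" using b c d \<open>b \<noteq> e\<close> by auto
  then show ?thesis using card_mono[of "B - {e}" "{b, c, d}"] finite_B by auto
qed

text \<open>
  If the exposed port belongs to \<open>e\<close>, a vertex can only fail to be a good root by having a port whose
  sole partner is \<open>e\<close>. At most two vertices besides \<open>e\<close> do, since \<open>e\<close> has two other ports.
\<close>

lemma good_root:
  obtains s s1 c where "s \<in> B" "\<And>i. s1 i \<in> B" "\<And>i. c i \<noteq> i" "\<And>i. pr s i = pr (s1 i) (c i)"
    "\<And>i j. \<not> exposed (s1 i) j"
proof -
  have "\<exists>s\<in>B. \<forall>i. \<exists>b\<in>B. \<exists>j. j \<noteq> i \<and> pr s i = pr b j \<and> (\<forall>l. \<not> exposed b l)"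
  proof (cases "\<exists>e\<in>B. \<exists>a. exposed e a")
    case False
    then show ?thesis using nonempty_B partner by (metis ex_in_conv)
  next
    case True
    then obtain e a where e: "e \<in> B" "exposed e a" by blast
    have only: "b = e" if "b \<in> B" "exposed b l" for b l using exposed_eq e that by blast
    show ?thesis
    proof (rule ccontr)
      assume "\<not> ?thesis"
      then have "\<forall>s\<in>B. \<exists>i. \<forall>b\<in>B. \<forall>j. j \<noteq> i \<longrightarrow> pr s i = pr b j \<longrightarrow> b = e"
        using only by metis
      then obtain f where f: "\<And>s b j. s \<in> B \<Longrightarrow> b \<in> B \<Longrightarrow> j \<noteq> f s \<Longrightarrow> pr s (f s) = pr b j \<Longrightarrow> b = e"
        by metis
      have "\<exists>j. j \<noteq> a \<and> j \<noteq> f s \<and> pr s (f s) = pr e j" if s: "s \<in> B - {e}" for s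
      proof -
        have "\<not> exposed s (f s)" using only s by blast
        then obtain b j where bj: "b \<in> B" "j \<noteq> f s" "pr s (f s) = pr b j" using partner by metis
        then have "b = e" using f s by blast
        moreover have "j \<noteq> a" using bj e(2) s \<open>b = e\<close> unfolding exposed_def by (metis DiffD1)
        ultimately show ?thesis using bj by blast
      qed
      then obtain g where g: "\<And>s. s \<in> B - {e} \<Longrightarrow> g s \<noteq> a \<and> g s \<noteq> f s \<and> pr s (f s) = pr e (g s)" by metis
      \<comment> \<open>If \<open>g s = g t\<close>, then \<open>t\<close> lies behind the port
        \<open>f s\<close> of \<open>s\<close> as well, although \<open>e\<close> is the only
        partner there.\<close>
      have "inj_on g (B - {e})"
      proof (rule inj_onI, rule ccontr)
        fix s t assume st: "s \<in> B - {e}" "t \<in> B - {e}" "g s = g t" "s \<noteq> t"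
        then have *: "pr s (f s) = pr t (f t)" using g by metis
        then have "f s \<noteq> f t" using pr_inj st(4) by metis
        with f[of s t "f t"] * st show False by auto
      qed
      moreover have "g ` (B - {e}) \<subseteq> UNIV - {a}" using g by blast
      moreover have "card (UNIV - {a}) = 2" by (cases a) (simp_all add: UNIV_col)
      moreover have "finite (UNIV :: col set)" by (simp add: UNIV_col)
      ultimately have "card (B - {e}) \<le> 2" by (metis card_inj_on_le finite_Diff)
      with card_Diff_exposed[OF e] show False by simp
    qed
  qed
  then obtain s where "s \<in> B" "\<forall>i. \<exists>b\<in>B. \<exists>j. j \<noteq> i \<and> pr s i = pr b j \<and> (\<forall>l. \<not> exposed b l)" by blast
  then show ?thesis using that by metis
qed

end

text \<open>Port \<open>i\<close> of the root leads to \<open>s1 i\<close>, entered at port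
  \<open>c i\<close>; port \<open>j\<close> of \<open>s1 i\<close> leads to \<open>u i j\<close>,
  entered at \<open>d i j\<close>. At \<open>j = c i\<close>, which leads back, \<open>u\<close> and
  \<open>d\<close> are left unconstrained.\<close>

locale port_tree = port_graph +
  fixes s s1 c u d
  assumes s1_ne: "\<And>i. c i \<noteq> i" and s1: "\<And>i. pr s i = pr (s1 i) (c i)"
    and d_ne: "\<And>i j. j \<noteq> c i \<Longrightarrow> d i j \<noteq> j"
    and u: "\<And>i j. j \<noteq> c i \<Longrightarrow> pr (s1 i) j = pr (u i j) (d i j)"
    and in_B: "s \<in> B" "\<And>i. s1 i \<in> B" "\<And>i j. j \<noteq> c i \<Longrightarrow> u i j \<in> B"
begin

lemma s1_ne_s: "s1 i \<noteq> s"
  using s1[of i] s1_ne[of i] pr_ne by metis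

lemma s1_inj: "s1 i = s1 k \<Longrightarrow> i = k"
  using two_cycle[of s i "s1 i" "c i" k "c k"] s1[of i] s1[of k] s1_ne[of i] s1_ne[of k] by metis

lemma u_ne_s: "j \<noteq> c i \<Longrightarrow> u i j \<noteq> s"
  using two_cycle[of "s1 i" j s "d i j" "c i" i] u[of j i] s1[of i] s1_ne[of i] d_ne[of j i] by metis

lemma u_ne_s1: "j \<noteq> c i \<Longrightarrow> u i j \<noteq> s1 k"
proof
  assume H: "j \<noteq> c i" "u i j = s1 k"
  show False
  proof (cases "i = k")
    case True
    then have "pr (s1 i) j = pr (s1 i) (d i j)" using u[OF H(1)] H(2) by simp
    then show False using pr_ne d_ne[OF H(1)] by metis
  next
    case False
    have "pr (s1 i) j = pr (s1 k) (d i j)" using u[OF H(1)] H(2) by simp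
    then show False
      using triangle[OF s1[of i] _ s1[of k, symmetric] s1_ne[of i, symmetric] d_ne[OF H(1), symmetric] s1_ne[of k]]
        H(1) by blast
  qed
qed

lemma u_inj: "j \<noteq> c i \<Longrightarrow> j' \<noteq> c i \<Longrightarrow> u i j = u i j' \<Longrightarrow> j = j'"
  using two_cycle[of "s1 i" j "u i j" "d i j" j' "d i j'"] u d_ne by metis

text \<open>Equal leaves close the 4-cycle through \<open>s\<close>, \<open>s1 i\<close>,
  \<open>u i j\<close> and \<open>s1 k\<close>. If both were entered at the same port, the two
  parents would share a product and form a triangle with \<open>s\<close>.\<close>

lemma coincidence:
  assumes "i \<noteq> k" "j \<noteq> c i" "l \<noteq> c k" "u i j = u k l"
  shows "[i, c i, j, d i j, d k l, l, c k, k] \<in> set (cyc K)"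
proof -
  have e: "pr (u i j) (d k l) = pr (s1 k) l" using u[OF assms(3)] assms(4) by simp
  have "d i j \<noteq> d k l"
  proof
    assume "d i j = d k l"
    then have e: "pr (s1 i) j = pr (s1 k) l" using u[OF assms(2)] e by simp
    have "j \<noteq> l" using e pr_inj s1_inj assms(1) by blast
    then show False
      using triangle[OF s1[of i] e s1[of k, symmetric] s1_ne[of i, symmetric] _ s1_ne[of k]] assms(2) by blast
  qed
  moreover have "s1 i \<noteq> s1 k" using s1_inj assms(1) by blast
  ultimately show ?thesis
    by (intro square[OF s1[of i] u[OF assms(2)] e s1[of k, symmetric] s1_ne[of i, symmetric]
        d_ne[OF assms(2), symmetric] d_ne[OF assms(3)] s1_ne[of k] assms(2)[symmetric]])
      (use u_ne_s[OF assms(2)] in auto)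
qed

section \<open>Counting the leaves of the tree\<close>

definition slots :: "(col \<times> col) set" where
  "slots = {(i, j). j \<noteq> c i}"

lemma slots_eq: "slots = (\<Union>i\<in>UNIV. Pair i ` (UNIV - {c i}))"
  by (auto simp: slots_def)

lemma finite_col: "finite (S :: col set)"
  using UNIV_col by (metis finite.emptyI finite_insert finite_subset top_greatest)

lemma card_slots: "card slots = 6"
proof -
  have "card (UNIV - {x :: col}) = 2" for x by (cases x) (simp_all add: UNIV_col)
  then have "card (Pair i ` (UNIV - {c i})) = 2" for i :: col by (simp add: card_image inj_on_def)
  then show ?thesis unfolding slots_eq
    by (subst card_UN_disjoint) (auto simp: finite_col UNIV_col)
qed

lemma finite_slots: "finite slots"
  using card_slots card.infinite by fastforce

definition leaves :: "'a set" where
  "leaves = case_prod u ` slots"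

lemma leaves_bound: "card B \<ge> 4 + card leaves"
proof -
  have "card (insert s (range s1)) = 4"
  proof -
    have "card (range s1) = 3" using card_image[of s1 UNIV] s1_inj by (simp add: inj_on_def UNIV_col)
    moreover have "s \<notin> range s1" using s1_ne_s by force
    ultimately show ?thesis using finite_col[of UNIV] by simp
  qed
  moreover have "insert s (range s1) \<inter> leaves = {}"
    using u_ne_s u_ne_s1 unfolding leaves_def slots_def by fastforce
  ultimately have "card (insert s (range s1) \<union> leaves) = 4 + card leaves"
    using finite_slots finite_col[of UNIV] by (subst card_Un_disjoint) (auto simp: leaves_def)
  moreover have "insert s (range s1) \<union> leaves \<subseteq> B"
    using in_B by (auto simp: leaves_def slots_def)
  ultimately show ?thesis using card_mono[OF finite_B] by metis
qed

text \<open>Six slots share at most four leaves. After one slot of a coinciding pair is removed,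
  five slots still share four leaves, which gives a second pair.\<close>

lemma two_coincidences:
  assumes "card B \<le> 8"
  obtains x y x' y' where "x \<in> slots" "y \<in> slots" "x' \<in> slots" "y' \<in> slots" "fst x \<noteq> fst y" "fst x' \<noteq> fst y'"
    "case_prod u x = case_prod u y" "case_prod u x' = case_prod u y'" "{x, y} \<noteq> {x', y'}"
proof -
  have small: "card leaves \<le> 4" using leaves_bound assms by simp
  then have "\<not> inj_on (case_prod u) slots" using card_image card_slots by (fastforce simp: leaves_def)
  then obtain x y where xy: "x \<in> slots" "y \<in> slots" "case_prod u x = case_prod u y" "x \<noteq> y"
    by (auto simp: inj_on_def)
  have "card (case_prod u ` (slots - {x})) \<le> 4"
    using small card_mono[of leaves "case_prod u ` (slots - {x})"] finite_slots
    unfolding leaves_def by (meson Diff_subset finite_imageI image_mono le_trans)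
  then have "\<not> inj_on (case_prod u) (slots - {x})"
    using card_image[of "case_prod u" "slots - {x}"] card_slots xy(1) finite_slots by auto
  then obtain x' y' where xy': "x' \<in> slots" "y' \<in> slots" "case_prod u x' = case_prod u y'" "x' \<noteq> y'"
    "x' \<noteq> x" "y' \<noteq> x" by (auto simp: inj_on_def)
  have "fst z \<noteq> fst w" if "z \<in> slots" "w \<in> slots" "case_prod u z = case_prod u w" "z \<noteq> w" for z w
    using that u_inj[of "snd z" "fst z" "snd w"] by (cases z; cases w) (auto simp: slots_def)
  then have "fst x \<noteq> fst y" "fst x' \<noteq> fst y'" using xy xy' by blast+
  moreover have "{x, y} \<noteq> {x', y'}" using xy' by blast
  ultimately show ?thesis using that xy xy' by blast
qed

end

context port_graph
begin

text \<open>
  The remaining configuration: \<open>s\<close> with neighbours \<open>s0, s1, s2\<close>, and \<open>q\<close>, \<open>r\<close> closing two squares.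
  Excluding 2- and 3-cycles and squares other than those of \<open>K9\<close>, the free ports of \<open>u\<close> can
  only lead to \<open>r, v\<close>, those of \<open>v\<close> only to \<open>q, u\<close>, and the one of \<open>q\<close> only to \<open>v\<close>.
\<close>

lemma K9_octet_absurd:
  assumes K: "K = K9" and B: "B = {s, s0, s1, s2, q, r, u, v}" and dist: "distinct [s, s0, s1, s2, q, r, u, v]"
    and s: "pr s C0 = pr s0 C2" "pr s C1 = pr s1 C0" "pr s C2 = pr s2 C0"
    and q: "pr s0 C1 = pr q C0" "pr s1 C2 = pr q C1"
    and r: "pr s1 C1 = pr r C2" "pr s2 C1 = pr r C0"
    and u: "pr s0 C0 = pr u f" "f \<noteq> C0" and v: "pr s2 C2 = pr v g" "g \<noteq> C2"
  shows False
proof -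
  have u_s0: False if "pr u h = pr s0 i" "h \<noteq> i" "h \<noteq> f" for h i
    using two_cycle[of u f s0 C0 h i] u that by auto
  have u_s2: False if "pr u h = pr s2 i" "h \<noteq> i" for h i
    using square[of u f s0 C0 C2 s C0 C2 s2 C0 i h] u s that dist by (auto simp: K)
  have u_s1: False if "pr u h = pr s1 i" "h \<noteq> i" for h i
    using square[of u f s0 C0 C2 s C0 C1 s1 C0 i h] u s that dist by (auto simp: K)
  have u_s: False if "pr u h = pr s i" "h \<noteq> i" for h i
    using triangle[of u f s0 C0 C2 s C0 i h] u s that by auto
  have u_q: False if "pr u h = pr q i" "h \<noteq> i" for h i
    using triangle[of u f s0 C0 C1 q C0 i h] u q that by auto
  have v_s2: False if "pr v h = pr s2 i" "h \<noteq> i" "h \<noteq> g" for h i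
    using two_cycle[of v g s2 C2 h i] v that by auto
  have v_s0: False if "pr v h = pr s0 i" "h \<noteq> i" for h i
    using square[of v g s2 C2 C0 s C2 C0 s0 C2 i h] v s that dist by (auto simp: K)
  have v_s1: False if "pr v h = pr s1 i" "h \<noteq> i" for h i
    using square[of v g s2 C2 C0 s C2 C1 s1 C0 i h] v s that dist by (auto simp: K)
  have v_s: False if "pr v h = pr s i" "h \<noteq> i" for h i
    using triangle[of v g s2 C2 C0 s C2 i h] v s that by auto
  have v_r: False if "pr v h = pr r i" "h \<noteq> i" for h i
    using triangle[of v g s2 C2 C1 r C0 i h] v r that by auto
  have q_s0: False if "pr q C2 = pr s0 i" "C2 \<noteq> i" for i
    using two_cycle[of q C0 s0 C1 C2 i] q that by auto
  have q_s1: False if "pr q C2 = pr s1 i" "C2 \<noteq> i" for i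
    using two_cycle[of q C1 s1 C2 C2 i] q that by auto
  have q_s: False if "pr q C2 = pr s i" "C2 \<noteq> i" for i
    using triangle[of q C0 s0 C1 C2 s C0 i C2] q s that by auto
  have q_r: False if "pr q C2 = pr r i" "C2 \<noteq> i" for i
    using triangle[of q C1 s1 C2 C1 r C2 i C2] q r that by auto
  have q_s2: False if "pr q C2 = pr s2 i" "C2 \<noteq> i" for i
    using square[of s2 C0 s C2 C1 s1 C0 C2 q C1 C2 i] q s that dist by (auto simp: K)
  have u_partner: "\<exists>w\<in>{r, v}. \<exists>i. i \<noteq> h \<and> pr u h = pr w i" if h: "h \<noteq> f" "\<not> exposed u h" for h
  proof -
    obtain b i where b: "b \<in> B" "i \<noteq> h" "pr u h = pr b i" using partner[OF h(2)] .
    have "b \<noteq> u" using b pr_ne by blast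
    with b show ?thesis using u_s0[of h i] u_s1[of h i] u_s2[of h i] u_s[of h i] u_q[of h i] h unfolding B by auto
  qed
  have v_partner: "\<exists>w\<in>{q, u}. \<exists>i. i \<noteq> h \<and> pr v h = pr w i" if h: "h \<noteq> g" "\<not> exposed v h" for h
  proof -
    obtain b i where b: "b \<in> B" "i \<noteq> h" "pr v h = pr b i" using partner[OF h(2)] .
    have "b \<noteq> v" using b pr_ne by blast
    with b show ?thesis using v_s0[of h i] v_s1[of h i] v_s2[of h i] v_s[of h i] v_r[of h i] h unfolding B by auto
  qed
  have q_partner: "\<exists>i. i \<noteq> C2 \<and> pr q C2 = pr v i" if h: "\<not> exposed q C2"
  proof -
    obtain b i where b: "b \<in> B" "i \<noteq> C2" "pr q C2 = pr b i" using partner[OF h] .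
    have "b \<noteq> q" using b pr_ne by blast
    with b show ?thesis using q_s0[of i] q_s1[of i] q_s2[of i] q_s[of i] q_r[of i] u_q[of i C2]
      unfolding B by auto
  qed
  have B_mem: "q \<in> B" "u \<in> B" "v \<in> B" by (auto simp: B)
  show False
  proof (cases "\<exists>h. h \<noteq> f \<and> exposed u h")
    case True
    then obtain h where h: "h \<noteq> f" "exposed u h" by blast
    \<comment> \<open>The exposed port belongs to \<open>u\<close>, so both free ports of
      \<open>v\<close> have partners; by \<open>two_cycle\<close> one of these is \<open>q\<close>
      and the other \<open>u\<close>.\<close>
    have v_cov: "\<not> exposed v i" for i using exposed_eq[OF _ h(2) B_mem(3,2)] dist by auto
    obtain m1 m2 where m: "m1 \<noteq> m2" "m1 \<noteq> g" "m2 \<noteq> g" using other_colors .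
    obtain w1 i1 where w1: "w1 \<in> {q, u}" "i1 \<noteq> m1" "pr v m1 = pr w1 i1" using v_partner[OF m(2) v_cov] by blast
    obtain w2 i2 where w2: "w2 \<in> {q, u}" "i2 \<noteq> m2" "pr v m2 = pr w2 i2" using v_partner[OF m(3) v_cov] by blast
    have "w1 \<noteq> w2" using two_cycle[of v m1 w1 i1 m2 i2] w1 w2 m by auto
    then obtain k1 k2 x n where k: "k1 \<noteq> k2" "k1 \<noteq> g" "k2 \<noteq> g" "x \<noteq> k1" "pr v k1 = pr u x"
      "n \<noteq> k2" "pr v k2 = pr q n"
      using that[of m1 m2 i1 i2] that[of m2 m1 i2 i1] w1 w2 m by auto
    have "x \<noteq> f" using k(4,5) u v_s0[of k1 C0] pr_inj[of v C0 s0] dist by auto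
    \<comment> \<open>The square through \<open>s0\<close>, \<open>u\<close>, \<open>v\<close>,
      \<open>q\<close>. The only matching reading of \<open>K9\<close> has \<open>k1 = C0\<close>
      and \<open>k2 = C1\<close>, which leaves the excluded value \<open>C2\<close> for
      \<open>g\<close>.\<close>
    then have "[C0, f, x, k1, k2, n, C0, C1] \<in> set (cyc K)"
      using k u q dist by (intro square[of s0 C0 u f x v k1 k2 q n C0 C1]) auto
    with k v(2) show False by (cases g) (auto simp: K)
  next
    case False
    then have u_cov: "\<not> exposed u h" if "h \<noteq> f" for h using that by blast
    obtain m1 m2 where m: "m1 \<noteq> m2" "m1 \<noteq> f" "m2 \<noteq> f" using other_colors .
    obtain w1 i1 where w1: "w1 \<in> {r, v}" "i1 \<noteq> m1" "pr u m1 = pr w1 i1" using u_partner[OF m(2) u_cov[OF m(2)]] by blast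
    obtain w2 i2 where w2: "w2 \<in> {r, v}" "i2 \<noteq> m2" "pr u m2 = pr w2 i2" using u_partner[OF m(3) u_cov[OF m(3)]] by blast
    have "w1 \<noteq> w2" using two_cycle[of u m1 w1 i1 m2 i2] w1 w2 m by auto
    then obtain f1 f2 x y where k: "f1 \<noteq> f2" "f1 \<noteq> f" "f2 \<noteq> f" "x \<noteq> f1" "pr u f1 = pr v x"
      "y \<noteq> f2" "pr u f2 = pr r y"
      using that[of m1 m2 i1 i2] that[of m2 m1 i2 i1] w1 w2 m by auto
    have "y \<noteq> C0" using k(6,7) r u_s2[of f2 C1] pr_inj[of u C1 s2] dist by auto
    then have "[x, f1, f2, y, C0, C1, C2, g] \<in> set (cyc K)"
      using k r v dist by (intro square[of v x u f1 f2 r y C0 s2 C1 C2 g]) auto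
    then have val: "x = C1" "f1 = C0" "g = C0" "f2 = C2" by (auto simp: K)
    have f: "f = C1" using k val by (cases f) auto
    \<comment> \<open>Either port \<open>C2\<close> of \<open>q\<close> has a partner, which is
      \<open>v\<close>, or it is the exposed one; then port \<open>C2\<close> of \<open>v\<close> is
      covered, and not by \<open>u\<close>, which already meets \<open>v\<close> through another
      port.\<close>
    have "\<exists>m n. m \<noteq> n \<and> pr v m = pr q n"
    proof (cases "exposed q C2")
      case False
      then show ?thesis using q_partner by metis
    next
      case True
      then have "\<not> exposed v C2" using exposed_eq[OF _ True B_mem(3,1)] dist by auto
      then obtain w i where w: "w \<in> {q, u}" "i \<noteq> C2" "pr v C2 = pr w i" using v_partner[of C2] val by auto
      have "w \<noteq> u" using two_cycle[of v C2 u i C1 C0] w k val by auto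
      with w have "C2 \<noteq> i \<and> pr v C2 = pr q i" by auto
      then show ?thesis by blast
    qed
    then obtain m n where mn: "m \<noteq> n" "pr v m = pr q n" by blast
    have "m \<noteq> C1" using u_q[of C0 n] pr_inj[of u C0 q] mn k(5) val dist by auto
    then have "[C0, C1, C0, C1, m, n, C0, C1] \<in> set (cyc K)"
      using mn k u q val f dist by (intro square[of s0 C0 u C1 C0 v C1 m q n C0 C1]) auto
    then show False by (auto simp: K)
  qed
qed

end

text \<open>Exchanging the first two colours preserves \<open>K9\<close> and exchanges its two exceptional trees.\<close>

fun swap01 :: "col \<Rightarrow> col" where
  "swap01 C0 = C1" | "swap01 C1 = C0" | "swap01 C2 = C2"

lemma swap01_idem [simp]: "swap01 (swap01 i) = i" by (cases i) auto

lemma swap01_eq [simp]: "swap01 i = swap01 j \<longleftrightarrow> i = j" by (metis swap01_idem)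

text \<open>The readings are spelled out letter by letter so that unknown ports can be solved for by
  case distinction.\<close>

lemma K4_cases:
  "[a, b, c, d, e, f, g, h] \<in> set (cyc K4) \<longleftrightarrow>
    (a = C0 \<and> b = C1 \<and> c = C0 \<and> d = C1 \<and> e = C0 \<and> f = C2 \<and> g = C1 \<and> h = C2) \<or>
    (a = C2 \<and> b = C1 \<and> c = C2 \<and> d = C0 \<and> e = C1 \<and> f = C0 \<and> g = C1 \<and> h = C0) \<or>
    (a = C0 \<and> b = C1 \<and> c = C0 \<and> d = C2 \<and> e = C1 \<and> f = C2 \<and> g = C0 \<and> h = C1) \<or>
    (a = C1 \<and> b = C0 \<and> c = C2 \<and> d = C1 \<and> e = C2 \<and> f = C0 \<and> g = C1 \<and> h = C0) \<or>
    (a = C0 \<and> b = C2 \<and> c = C1 \<and> d = C2 \<and> e = C0 \<and> f = C1 \<and> g = C0 \<and> h = C1) \<or>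
    (a = C1 \<and> b = C0 \<and> c = C1 \<and> d = C0 \<and> e = C2 \<and> f = C1 \<and> g = C2 \<and> h = C0) \<or>
    (a = C1 \<and> b = C2 \<and> c = C0 \<and> d = C1 \<and> e = C0 \<and> f = C1 \<and> g = C0 \<and> h = C2) \<or>
    (a = C2 \<and> b = C0 \<and> c = C1 \<and> d = C0 \<and> e = C1 \<and> f = C0 \<and> g = C2 \<and> h = C1)"
  by (simp only: spins.simps append.simps rev.simps list.set insert_iff list.inject empty_iff simp_thms)

lemma K9_cases:
  "[a, b, c, d, e, f, g, h] \<in> set (cyc K9) \<longleftrightarrow>
    (a = C0 \<and> b = C1 \<and> c = C0 \<and> d = C2 \<and> e = C1 \<and> f = C0 \<and> g = C1 \<and> h = C2) \<or>
    (a = C2 \<and> b = C1 \<and> c = C0 \<and> d = C1 \<and> e = C2 \<and> f = C0 \<and> g = C1 \<and> h = C0) \<or>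
    (a = C0 \<and> b = C2 \<and> c = C1 \<and> d = C0 \<and> e = C1 \<and> f = C2 \<and> g = C0 \<and> h = C1) \<or>
    (a = C1 \<and> b = C0 \<and> c = C2 \<and> d = C1 \<and> e = C0 \<and> f = C1 \<and> g = C2 \<and> h = C0) \<or>
    (a = C1 \<and> b = C0 \<and> c = C1 \<and> d = C2 \<and> e = C0 \<and> f = C1 \<and> g = C0 \<and> h = C2) \<or>
    (a = C2 \<and> b = C0 \<and> c = C1 \<and> d = C0 \<and> e = C2 \<and> f = C1 \<and> g = C0 \<and> h = C1) \<or>
    (a = C1 \<and> b = C2 \<and> c = C0 \<and> d = C1 \<and> e = C0 \<and> f = C2 \<and> g = C1 \<and> h = C0) \<or>
    (a = C0 \<and> b = C1 \<and> c = C2 \<and> d = C0 \<and> e = C1 \<and> f = C0 \<and> g = C2 \<and> h = C1)"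
  by (simp only: spins.simps append.simps rev.simps list.set insert_iff list.inject empty_iff simp_thms)

section \<open>Which coincidences can occur together\<close>

context port_tree
begin

lemma coincidences:
  assumes "card B \<le> 8"
  obtains i j k l i' j' k' l' where "u i j = u k l" "u i' j' = u k' l'" "{(i, j), (k, l)} \<noteq> {(i', j'), (k', l')}"
    "[i, c i, j, d i j, d k l, l, c k, k] \<in> set (cyc K)"
    "[i', c i', j', d i' j', d k' l', l', c k', k'] \<in> set (cyc K)"
proof -
  obtain x y x' y' where *: "x \<in> slots" "y \<in> slots" "x' \<in> slots" "y' \<in> slots" "fst x \<noteq> fst y" "fst x' \<noteq> fst y'"
    "case_prod u x = case_prod u y" "case_prod u x' = case_prod u y'" "{x, y} \<noteq> {x', y'}"
    using two_coincidences[OF assms] by blast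
  show ?thesis
    using that[of "fst x" "snd x" "fst y" "snd y" "fst x'" "snd x'" "fst y'" "snd y'"]
      coincidence[of "fst x" "fst y" "snd x" "snd y"] coincidence[of "fst x'" "fst y'" "snd x'" "snd y'"] *
    by (simp add: slots_def case_prod_beta del: spins.simps)
qed

text \<open>Four 4-cycles through the root fit \<open>K4\<close>, and any two of them demand
  different values of \<open>c\<close> or \<open>d\<close>.\<close>

lemma K4_bound:
  assumes K: "K = K4"
  shows "card B \<ge> 9"
proof (rule ccontr)
  assume "\<not> ?thesis"
  then have "card B \<le> 8" by simp
  then obtain i j k l i' j' k' l' where uu: "{(i, j), (k, l)} \<noteq> {(i', j'), (k', l')}"
    and m: "[i, c i, j, d i j, d k l, l, c k, k] \<in> set (cyc K4)"
      "[i', c i', j', d i' j', d k' l', l', c k', k'] \<in> set (cyc K4)"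
    using coincidences unfolding K by metis
  from m uu show False
    unfolding K4_cases by (elim disjE conjE; simp add: doubleton_eq_iff)
qed

text \<open>Again four 4-cycles through the root are possible; of their six pairs just these two
  agree on \<open>c\<close>.\<close>

lemma K9_coincidences:
  assumes K: "K = K9" and "card B \<le> 8"
  shows "(c C0 = C2 \<and> c C1 = C0 \<and> c C2 = C0 \<and> u C0 C1 = u C1 C2 \<and> d C0 C1 = C0 \<and> d C1 C2 = C1 \<and>
      u C1 C1 = u C2 C1 \<and> d C1 C1 = C2 \<and> d C2 C1 = C0) \<or>
    (c C0 = C1 \<and> c C1 = C2 \<and> c C2 = C1 \<and> u C0 C0 = u C2 C0 \<and> d C0 C0 = C2 \<and> d C2 C0 = C1 \<and>
      u C0 C2 = u C1 C0 \<and> d C0 C2 = C0 \<and> d C1 C0 = C1)"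
proof -
  obtain i j k l i' j' k' l' where uu: "u i j = u k l" "u i' j' = u k' l'"
      "{(i, j), (k, l)} \<noteq> {(i', j'), (k', l')}"
    and m: "[i, c i, j, d i j, d k l, l, c k, k] \<in> set (cyc K9)"
      "[i', c i', j', d i' j', d k' l', l', c k', k'] \<in> set (cyc K9)"
    using coincidences[OF assms(2)] unfolding K by metis
  from m uu show ?thesis
    unfolding K9_cases by (elim disjE conjE; simp add: doubleton_eq_iff)
qed

end

context port_graph
begin

lemma swapped:
  assumes K: "K = K9"
  shows "port_graph B (\<lambda>b i. pr b (swap01 i)) K9"
proof
  show "finite B" "B \<noteq> {}" by (rule finite_B nonempty_B)+
  show "b = c" if "pr b (swap01 i) = pr c (swap01 i)" for b c i using that by (rule pr_inj)
  show "i = j" if "pr b (swap01 i) = pr b (swap01 j)" for b i j using pr_ne[OF that] by simp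
  show "b = c \<and> i = j" if bc: "b \<in> B" "c \<in> B"
    and b: "\<And>b' i'. b' \<in> B \<Longrightarrow> pr b' (swap01 i') = pr b (swap01 i) \<Longrightarrow> i' = i"
    and c: "\<And>b' i'. b' \<in> B \<Longrightarrow> pr b' (swap01 i') = pr c (swap01 j) \<Longrightarrow> i' = j" for b c i j
  proof -
    have "b = c \<and> swap01 i = swap01 j"
      by (rule exposed_unique[OF bc]) (metis b swap01_idem, metis c swap01_idem)
    then show ?thesis by simp
  qed
next
  fix a b i i' j j'
  assume "pr a (swap01 i) = pr b (swap01 i')" "pr b (swap01 j) = pr a (swap01 j')" "distinct_adj [i, i', j, j', i]"
  then show False using digon_free[of a "swap01 i" b "swap01 i'" "swap01 j" "swap01 j'"] by simp
next
  fix a b c i i' j j' k k'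
  assume "pr a (swap01 i) = pr b (swap01 i')" "pr b (swap01 j) = pr c (swap01 j')"
    "pr c (swap01 k) = pr a (swap01 k')" "distinct_adj [i, i', j, j', k, k', i]"
  then show False
    using triangle_free[of a "swap01 i" b "swap01 i'" "swap01 j" c "swap01 j'" "swap01 k" "swap01 k'"] by simp
next
  fix a b c d i i' j j' k k' l l'
  assume "pr a (swap01 i) = pr b (swap01 i')" "pr b (swap01 j) = pr c (swap01 j')"
    "pr c (swap01 k) = pr d (swap01 k')" "pr d (swap01 l) = pr a (swap01 l')"
    "distinct_adj [i, i', j, j', k, k', l, l', i]"
  then have "[swap01 i, swap01 i', swap01 j, swap01 j', swap01 k, swap01 k', swap01 l, swap01 l'] \<in> set (cyc K9)"
    using square_word[of a "swap01 i" b "swap01 i'" "swap01 j" c "swap01 j'" "swap01 k" d "swap01 k'" "swap01 l" "swap01 l'"]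
    unfolding K by simp
  moreover have "swap01 x = y \<longleftrightarrow> x = swap01 y" for x y by (cases x; cases y) simp_all
  ultimately show "[i, i', j, j', k, k', l, l'] \<in> set (cyc K9)"
    unfolding K9_cases by (elim disjE conjE; simp)
qed

end

context port_tree
begin

lemma octet:
  assumes "card B \<le> 8" "distinct xs" "length xs = 8" "set xs \<subseteq> B"
  shows "B = set xs"
  using assms card_seteq[OF finite_B assms(4)] distinct_card[OF assms(2)] by simp

lemma s1_neq: "i \<noteq> k \<Longrightarrow> s1 i \<noteq> s1 k"
  using s1_inj by blast

lemma K9_bound:
  assumes K: "K = K9"
  shows "card B \<ge> 9"
proof (rule ccontr)
  assume "\<not> ?thesis"
  then have small: "card B \<le> 8" by simp
  have u_neq: "u i j \<noteq> u k l" if "i \<noteq> k" "j \<noteq> c i" "l \<noteq> c k" "[i, c i, j, d i j, d k l, l, c k, k] \<notin> set (cyc K9)" for i j k l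
    using coincidence[OF that(1-3)] that(4) K by blast
  from K9_coincidences[OF K small] show False
  proof (elim disjE conjE)
    assume c: "c C0 = C2" "c C1 = C0" "c C2 = C0"
      and q: "u C0 C1 = u C1 C2" "d C0 C1 = C0" "d C1 C2 = C1"
      and r: "u C1 C1 = u C2 C1" "d C1 C1 = C2" "d C2 C1 = C0"
    \<comment> \<open>A further coincidence would need a word that is not a reading of
      \<open>K9\<close>, or two equal leaves at one parent. So exactly four leaves remain, and
      \<open>B\<close> is the tree.\<close>
    have "u C0 C1 \<noteq> u C1 C1" "u C0 C1 \<noteq> u C0 C0" "u C0 C1 \<noteq> u C2 C2"
      "u C1 C1 \<noteq> u C0 C0" "u C1 C1 \<noteq> u C2 C2" "u C0 C0 \<noteq> u C2 C2"
      using u_neq[of C0 C1 C1 C1] u_inj[of C1 C0 C0] u_neq[of C0 C2 C1 C2] u_neq[of C1 C0 C1 C0] u_inj[of C1 C2 C2]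
        u_neq[of C0 C2 C0 C2] c q r K9_cases by auto
    then have dist: "distinct [s, s1 C0, s1 C1, s1 C2, u C0 C1, u C1 C1, u C0 C0, u C2 C2]"
      by (simp add: c s1_neq s1_ne_s[THEN not_sym] u_ne_s[THEN not_sym] u_ne_s1[THEN not_sym])
    have B: "B = {s, s1 C0, s1 C1, s1 C2, u C0 C1, u C1 C1, u C0 C0, u C2 C2}"
      using octet[OF small dist] in_B c by simp
    show False
      using K9_octet_absurd[OF K B dist, of "d C0 C0" "d C2 C2"] s1[of C0] s1[of C1] s1[of C2]
        u[of C1 C0] u[of C2 C1] u[of C1 C1] u[of C1 C2] u[of C0 C0] u[of C2 C2] d_ne[of C0 C0] d_ne[of C2 C2] c q r
      by simp
  next
    assume c: "c C0 = C1" "c C1 = C2" "c C2 = C1"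
      and r: "u C0 C0 = u C2 C0" "d C0 C0 = C2" "d C2 C0 = C1"
      and q: "u C0 C2 = u C1 C0" "d C0 C2 = C0" "d C1 C0 = C1"
    have "u C1 C0 \<noteq> u C0 C0" "u C1 C0 \<noteq> u C1 C1" "u C1 C0 \<noteq> u C2 C2"
      "u C0 C0 \<noteq> u C1 C1" "u C0 C0 \<noteq> u C2 C2" "u C1 C1 \<noteq> u C2 C2"
      using u_neq[of C1 C0 C0 C0] u_inj[of C0 C1 C1] u_neq[of C1 C2 C0 C2] u_neq[of C0 C1 C0 C1] u_neq[of C0 C2 C0 C2]
        u_neq[of C1 C2 C1 C2] u_inj[of C0 C2 C2] c q r K9_cases by auto
    then have dist: "distinct [s, s1 C1, s1 C0, s1 C2, u C1 C0, u C0 C0, u C1 C1, u C2 C2]"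
      by (simp add: c s1_neq s1_ne_s[THEN not_sym] u_ne_s[THEN not_sym] u_ne_s1[THEN not_sym])
    have B: "B = {s, s1 C1, s1 C0, s1 C2, u C1 C0, u C0 C0, u C1 C1, u C2 C2}"
      using octet[OF small dist] in_B c by simp
    \<comment> \<open>The second tree mirrors the first, with the colours \<open>C0\<close> and
      \<open>C1\<close>, and hence \<open>s1 C0\<close> and \<open>s1 C1\<close>, exchanged.\<close>
    interpret sw: port_graph B "\<lambda>b i. pr b (swap01 i)" K9 using swapped[OF K] .
    show False
      using sw.K9_octet_absurd[OF refl B dist, of "swap01 (d C1 C1)" "swap01 (d C2 C2)"] s1[of C0] s1[of C1] s1[of C2]
        u[of C0 C0] u[of C2 C0] u[of C0 C1] u[of C1 C1] u[of C0 C2] u[of C2 C2] d_ne[of C1 C1] d_ne[of C2 C2] c q r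
      by (cases "d C1 C1"; cases "d C2 C2") simp_all
  qed
qed

end

section \<open>From the tree back to supports in the group algebra\<close>

lemma (in port_graph) card_B_ge_9:
  assumes "K \<in> {K4, K9}"
  shows "card B \<ge> 9"
proof -
  obtain s s1 c where root: "s \<in> B" "\<And>i. s1 i \<in> B" "\<And>i. c i \<noteq> i" "\<And>i. pr s i = pr (s1 i) (c i)"
    "\<And>i j. \<not> exposed (s1 i) j" using good_root by blast
  have "\<forall>i j. \<exists>b l. b \<in> B \<and> l \<noteq> j \<and> pr (s1 i) j = pr b l"
    using partner[OF root(5)] by metis
  then obtain u where "\<forall>i j. \<exists>l. u i j \<in> B \<and> l \<noteq> j \<and> pr (s1 i) j = pr (u i j) l" by metis
  then obtain d where "\<And>i j. u i j \<in> B \<and> d i j \<noteq> j \<and> pr (s1 i) j = pr (u i j) (d i j)" by metis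
  then interpret port_tree B pr K s s1 c u d by unfold_locales (use root in auto)
  show ?thesis using assms K4_bound K9_bound by blast
qed

lemma (in three_by) card_B_ge_9: "card B \<ge> 9"
proof -
  obtain h K where h: "coloring h" and K: "K \<in> {K4, K9}"
    and rel: "\<And>c. c \<in> set (closed_walks 7) \<Longrightarrow> alt (map h c) = 0 \<Longrightarrow> c \<in> set (cyc K)"
    using normal_coloring by blast
  have A: "A = range h" using h by (simp add: coloring_def)
  have "inj h"
  proof (rule eq_card_imp_inj_on)
    show "finite (UNIV :: col set)" "card (h ` UNIV) = card (UNIV :: col set)"
      using card_A A by (simp_all add: UNIV_col)
  qed
  then have hh: "h i = h j \<longleftrightarrow> i = j" for i j by (simp add: inj_eq)
  have step: "b = (- h i' + h i) + a" if "h i + a = h i' + b" for a b i i'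
    using arg_cong[OF that, of "(+) (- h i')"] by (simp only: add.assoc minus_add_cancel)
  interpret port_graph B "\<lambda>b i. h i + b" K
  proof
    show "finite B" "B \<noteq> {}" by (rule B)+
    show "b = c" if "h i + b = h i + c" for b c i using that by simp
    show "i = j" if "h i + b = h j + b" for b i j using that hh by simp
    show "b = c \<and> i = j" if "b \<in> B" "c \<in> B"
      and b: "\<And>b' i'. b' \<in> B \<Longrightarrow> h i' + b' = h i + b \<Longrightarrow> i' = i"
      and c: "\<And>b' i'. b' \<in> B \<Longrightarrow> h i' + b' = h j + c \<Longrightarrow> i' = j" for b c i j
    proof -
      have "h i = h j \<and> b = c"
        by (rule unique_product_eq) (use that A in auto)
      then show ?thesis using hh by simp
    qed
  next
    fix a b i i' j j'
    assume e: "h i + a = h i' + b" "h j + b = h j' + a" and d: "distinct_adj [i, i', j, j', i]"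
    have "alt (map h [i, i', j, j']) + a = a"
      using step[OF e(1)] step[OF e(2)] by (simp add: add.assoc)
    then have "alt (map h [i, i', j, j']) = 0" by (metis add_right_imp_eq add_0_left)
    then show False using no_short_cycles(1)[OF h closed_walks_mem(1)] d by auto
  next
    fix a b c i i' j j' k k'
    assume e: "h i + a = h i' + b" "h j + b = h j' + c" "h k + c = h k' + a"
      and d: "distinct_adj [i, i', j, j', k, k', i]"
    have "alt (map h [i, i', j, j', k, k']) + a = a"
      using step[OF e(1)] step[OF e(2)] step[OF e(3)] by (simp add: add.assoc)
    then have "alt (map h [i, i', j, j', k, k']) = 0" by (metis add_right_imp_eq add_0_left)
    then show False using no_short_cycles(2)[OF h closed_walks_mem(2)] d by auto
  next
    fix a b c w i i' j j' k k' l l'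
    assume e: "h i + a = h i' + b" "h j + b = h j' + c" "h k + c = h k' + w" "h l + w = h l' + a"
      and d: "distinct_adj [i, i', j, j', k, k', l, l', i]"
    have "alt (map h [i, i', j, j', k, k', l, l']) + a = a"
      using step[OF e(1)] step[OF e(2)] step[OF e(3)] step[OF e(4)] by (simp add: add.assoc)
    then have "alt (map h [i, i', j, j', k, k', l, l']) = 0" by (metis add_right_imp_eq add_0_left)
    then show "[i, i', j, j', k, k', l, l'] \<in> set (cyc K)" using rel[OF closed_walks_mem(3)] d by simp
  qed
  show ?thesis using card_B_ge_9[OF K] .
qed

text \<open>For each \<open>l\<close> the second factor is forced to be
  \<open>- l + (a + b)\<close>, so uniqueness leaves only the term \<open>l = a\<close> of the
  convolution.\<close>

lemma lookup_mult_unique_product: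
  fixes \<gamma> \<delta> :: "'g::group_add \<Rightarrow>\<^sub>0 'f::semiring_0"
  assumes "\<And>a' b'. \<lbrakk>a' \<in> Poly_Mapping.keys \<gamma>; b' \<in> Poly_Mapping.keys \<delta>; a' + b' = a + b\<rbrakk> \<Longrightarrow> a' = a"
  shows "Poly_Mapping.lookup (\<gamma> * \<delta>) (a + b) = Poly_Mapping.lookup \<gamma> a * Poly_Mapping.lookup \<delta> b"
proof -
  have "a + b = l + q \<longleftrightarrow> q = - l + (a + b)" for l q :: 'g
    by (metis add_minus_cancel minus_add_cancel)
  then have "Poly_Mapping.lookup (\<gamma> * \<delta>) (a + b) =
      (\<Sum>l. Poly_Mapping.lookup \<gamma> l * Poly_Mapping.lookup \<delta> (- l + (a + b)))"
    by (simp add: lookup_mult)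
  moreover have "Poly_Mapping.lookup \<gamma> l * Poly_Mapping.lookup \<delta> (- l + (a + b)) =
      (Poly_Mapping.lookup \<gamma> a * Poly_Mapping.lookup \<delta> b when l = a)" for l
    using assms[of l "- l + (a + b)"]
    by (cases "Poly_Mapping.lookup \<gamma> l = 0"; cases "Poly_Mapping.lookup \<delta> (- l + (a + b)) = 0"; cases "l = a")
      (auto simp: in_keys_iff)
  ultimately show ?thesis by simp
qed

theorem theorem1p7:
  fixes \<gamma> \<delta> :: "'g::group_add \<Rightarrow>\<^sub>0 'f::field"
  assumes "torsion_free TYPE('g)"
    and "card (Poly_Mapping.keys \<gamma>) = 3"
    and "\<gamma> * \<delta> = 1"
  shows "card (Poly_Mapping.keys \<delta>) \<ge> 9"
proof -
  have unique: "a + b = 0" if "a \<in> Poly_Mapping.keys \<gamma>" "b \<in> Poly_Mapping.keys \<delta>"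
    "\<And>a' b'. \<lbrakk>a' \<in> Poly_Mapping.keys \<gamma>; b' \<in> Poly_Mapping.keys \<delta>; a' + b' = a + b\<rbrakk> \<Longrightarrow> a' = a" for a b
  proof -
    have "Poly_Mapping.lookup 1 (a + b) = Poly_Mapping.lookup \<gamma> a * Poly_Mapping.lookup \<delta> b"
      using lookup_mult_unique_product[of \<gamma> \<delta> a b] that(3) assms(3) by simp
    also have "\<dots> \<noteq> 0" using that by (simp add: in_keys_iff)
    finally show ?thesis by (auto simp: lookup_one split: if_splits)
  qed
  interpret three_by "Poly_Mapping.keys \<gamma>" "Poly_Mapping.keys \<delta>"
  proof
    show "Poly_Mapping.keys \<delta> \<noteq> {}" using assms(3) by (metis keys_eq_empty mult_zero_right zero_neq_one)
    show "a = c \<and> b = d" if "a \<in> Poly_Mapping.keys \<gamma>" "b \<in> Poly_Mapping.keys \<delta>" "c \<in> Poly_Mapping.keys \<gamma>" "d \<in> Poly_Mapping.keys \<delta>"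
      and ab: "\<And>a' b'. \<lbrakk>a' \<in> Poly_Mapping.keys \<gamma>; b' \<in> Poly_Mapping.keys \<delta>; a' + b' = a + b\<rbrakk> \<Longrightarrow> a' = a"
      and cd: "\<And>a' b'. \<lbrakk>a' \<in> Poly_Mapping.keys \<gamma>; b' \<in> Poly_Mapping.keys \<delta>; a' + b' = c + d\<rbrakk> \<Longrightarrow> a' = c" for a b c d
    proof -
      have eq: "a + b = c + d" using unique that by metis
      then have "a = c" using cd[OF that(1,2)] by simp
      with eq show ?thesis by simp
    qed
  qed (use assms in auto)
  show ?thesis by (rule card_B_ge_9)
qed

end
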